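(* Let $\mathbf D$ be a generalized divergence and let $\Theta_1,\Theta_2$ be two superchannels. For any (fully general) adaptive superchannel discrimination strategy using $n$ copies of the superchannel, with final decision distributions $p$ (if the superchannel is $\Theta_1$) and $q$ (if it is $\Theta_2$), one has $$\mathbf D(p\|q)\;\le\; n\,\mathbf D^{A^*}(\Theta_1\|\Theta_2).$$
   Context: All systems are finite-dimensional; channels are completely positive trace-preserving maps; identity maps on systems not acted upon are omitted. $R$ denotes reference systems. Generalized divergence: a function $\mathbf D$ of pairs of states with values in $\mathbb R\cup\{+\infty\}$ satisfying $\mathbf D(\rho\|\sigma)\ge\mathbf D(\mathcal N(\rho)\|\mathcal N(\sigma))$ for all states and channels. Probability distributions are viewed as diagonal states. Amortized channel divergence: $\mathbf D^A(\mathcal N\|\mathcal M)=\sup_{\rho,\tau}\big[\mathbf D((\mathcal N\otimes\mathrm{id}_R)(\rho)\|(\mathcal M\otimes\mathrm{id}_R)(\tau))-\mathbf D(\rho\|\tau)\big]$, over states $\rho,\tau$ of input plus reference. Superchannel: $\Theta$ is given by channels $(\mathcal E_{\Theta}:C\to AS,\ \mathcal D_{\Theta}:BS\to D)$; it maps a channel $\mathcal N_{AR\to BR}$ to $(\Theta\otimes\mathrm{id}_R)(\mathcal N)=\mathcal D_\Theta\circ\mathcal N\circ\mathcal E_\Theta$ from $CR$ to $DR$. Fully-amortized superchannel divergence: $$\mathbf D^{A^*}(\Theta_1\|\Theta_2)=\sup_{\mathcal N,\mathcal M,\bar{\mathcal N},\bar{\mathcal M}}\ \inf_{\mathcal F}\Big[\mathbf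 D^A\big((\Theta_1\otimes\mathrm{id}_R)(\mathcal N)\circ\bar{\mathcal N}\,\big\|\,(\Theta_2\otimes\mathrm{id}_R)(\mathcal M)\circ\bar{\mathcal M}\big)-\mathbf D^A\big(\mathcal N\circ\mathcal F\circ\bar{\mathcal N}\,\big\|\,\mathcal M\circ\mathcal F\circ\bar{\mathcal M}\big)\Big],$$ where $\mathcal N,\mathcal M$ are channels $AR\to BR$, $\bar{\mathcal N},\bar{\mathcal M}$ are channels with output $CR$, and $\mathcal F$ ranges over arbitrary channels $C\to AR'$ with $R'$ an additional reference system. Fully general adaptive strategy with $n$ copies: take the $2n$ component channels $\mathcal E_\Theta^{(j)},\mathcal D_\Theta^{(j)}$ ($j=1,\dots,n$, the $j$-th pair connected by its own memory system $S_j$) and arrange them in any order $T_1,\dots,T_{2n}$ in which each $\mathcal E_\Theta^{(j)}$ precedes $\mathcal D_\Theta^{(j)}$. Starting from a state $\rho_{CR}$, apply $T_1,\mathcal A_1,T_2,\mathcal A_2,\dots,\mathcal A_{2n-1},T_{2n}$ in this order, where $\mathcal A_1,\dots,\mathcal A_{2n-1}$ are arbitrary channels acting on all systems except the memory systems $S_j$. Finally measure with a binary POVM. The order, the state, the $\mathcal A_i$ and the POVM are the same for $\Theta=\Theta_1$ and $\Theta=\Theta_2$; $p$ and $q$ are the resulting binary outcome distributions.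
   Formalization: Adds the assumption D(ρ‖ρ) ≤ 0 for all states, without which the claim fails (D ≡ 1 satisfies data processing but gives D(p‖q) = 1 and D^{A*} = 0); a difference in which +∞ is subtracted is read as −∞. *)

theory Defs
  imports "Jordan_Normal_Form.Matrix" "HOL-Library.Extended_Real"
begin

section \<open>States and channels\<close>

text \<open>
  A finite-dimensional system is represented by its dimension, a positive natural number; operators
  on it are square complex matrices. The tensor product of systems of dimensions \<open>d\<^sub>1, d\<^sub>2\<close> has
  dimension \<open>d\<^sub>1 * d\<^sub>2\<close>, and the basis vector \<open>|i> \<otimes> |j>\<close> has the index \<open>i * d\<^sub>2 + j\<close>. This tensor
  product is strictly associative, and the system of dimension 1 is its strict unit.
\<close>

definition tr :: "complex mat \<Rightarrow> complex" where
  "tr X = (\<Sum>i<dim_row X. X $$ (i, i))"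

text \<open>The order on \<^typ>\<open>complex\<close> is such that \<open>0 \<le> z\<close> means that \<open>z\<close> is real and nonnegative. Over
  the complex numbers the condition below implies that \<open>X\<close> is Hermitian.\<close>

definition psd :: "nat \<Rightarrow> complex mat \<Rightarrow> bool" where
  "psd d X \<longleftrightarrow> X \<in> carrier_mat d d \<and> (\<forall>v \<in> carrier_vec d. 0 \<le> (X *\<^sub>v v) \<bullet>c v)"

definition states :: "nat \<Rightarrow> complex mat set" where
  "states d = {\<rho>. psd d \<rho> \<and> tr \<rho> = 1}"

text \<open>\<open>amp l d e r \<Phi>\<close> is \<open>id\<^sub>l \<otimes> \<Phi> \<otimes> id\<^sub>r\<close> for a linear map \<open>\<Phi>\<close> from operators on a
  \<open>d\<close>-dimensional system to operators on an \<open>e\<close>-dimensional one: \<open>\<Phi>\<close> is applied to each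
  of the \<open>d \<times> d\<close> blocks obtained by fixing the row and column indices of both outer systems.\<close>

definition amp :: "nat \<Rightarrow> nat \<Rightarrow> nat \<Rightarrow> nat \<Rightarrow> (complex mat \<Rightarrow> complex mat) \<Rightarrow> complex mat \<Rightarrow> complex mat"
  where
  "amp l d e r \<Phi> X = mat (l * e * r) (l * e * r) (\<lambda>(i, j).
     \<Phi> (mat d d (\<lambda>(k, m). X $$ ((i div (e * r) * d + k) * r + i mod r,
                                (j div (e * r) * d + m) * r + j mod r)))
       $$ (i div r mod e, j div r mod e))"

text \<open>Completely positive trace-preserving maps. A channel is a function on all matrices, of which
  only the values on \<^term>\<open>carrier_mat d d\<close> are meaningful.\<close>

definition channels :: "nat \<Rightarrow> nat \<Rightarrow> (complex mat \<Rightarrow> complex mat) set" where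
  "channels d e = {\<Phi>. 0 < d \<and> 0 < e
     \<and> (\<forall>X \<in> carrier_mat d d. \<Phi> X \<in> carrier_mat e e)
     \<and> (\<forall>X \<in> carrier_mat d d. \<forall>Y \<in> carrier_mat d d. \<Phi> (X + Y) = \<Phi> X + \<Phi> Y)
     \<and> (\<forall>X \<in> carrier_mat d d. \<forall>z. \<Phi> (z \<cdot>\<^sub>m X) = z \<cdot>\<^sub>m \<Phi> X)
     \<and> (\<forall>k. \<forall>X. psd (d * k) X \<longrightarrow> psd (e * k) (amp 1 d e k \<Phi> X))
     \<and> (\<forall>X \<in> carrier_mat d d. tr (\<Phi> X) = tr X)}"

section \<open>Divergences\<close>

text \<open>A divergence is only meaningful on pairs of states of equal dimension, on which it takes values
  in \<open>\<real> \<union> {+\<infinity>}\<close>.\<close>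

definition generalized_divergence :: "(complex mat \<Rightarrow> complex mat \<Rightarrow> ereal) \<Rightarrow> bool" where
  "generalized_divergence D \<longleftrightarrow>
     (\<forall>d. \<forall>\<rho> \<in> states d. \<forall>\<sigma> \<in> states d. D \<rho> \<sigma> \<noteq> -\<infinity>)
     \<and> (\<forall>d e. \<forall>\<Phi> \<in> channels d e. \<forall>\<rho> \<in> states d. \<forall>\<sigma> \<in> states d. D (\<Phi> \<rho>) (\<Phi> \<sigma>) \<le> D \<rho> \<sigma>)"

text \<open>Data processing forces all values \<open>D \<rho> \<rho>\<close> to equal the value at the one-dimensional state,
  but leaves that value free: the constant function 1 satisfies data processing. Amortized
  divergences do not see this value, hence can bound the divergence of measurement outcomes only if
  it is at most 0. The usual divergences have \<open>D \<rho> \<rho> = 0\<close>.\<close>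

definition weakly_faithful :: "(complex mat \<Rightarrow> complex mat \<Rightarrow> ereal) \<Rightarrow> bool" where
  "weakly_faithful D \<longleftrightarrow> (\<forall>d. \<forall>\<rho> \<in> states d. D \<rho> \<rho> \<le> 0)"

text \<open>The difference of two divergences. The library has \<open>\<infinity> - \<infinity> = \<infinity>\<close> on \<^typ>\<open>ereal\<close>, which would make
  the suprema below infinite as soon as one pair with infinite divergence stays perfectly
  distinguishable. Here subtracting \<open>\<infinity>\<close> always gives \<open>-\<infinity>\<close>, so that such
  pairs do not contribute to the suprema.\<close>

definition div_diff :: "ereal \<Rightarrow> ereal \<Rightarrow> ereal" where
  "div_diff x y = (if y = \<infinity> then -\<infinity> else x - y)"

definition amortized_div ::
  "(complex mat \<Rightarrow> complex mat \<Rightarrow> ereal) \<Rightarrow> nat \<Rightarrow> nat \<Rightarrow>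
   (complex mat \<Rightarrow> complex mat) \<Rightarrow> (complex mat \<Rightarrow> complex mat) \<Rightarrow> ereal" where
  "amortized_div D d e N M =
     Sup {div_diff (D (amp 1 d e k N \<rho>) (amp 1 d e k M \<tau>)) (D \<rho> \<tau>) | k \<rho> \<tau>.
            \<rho> \<in> states (d * k) \<and> \<tau> \<in> states (d * k)}"

section \<open>Superchannels\<close>

text \<open>The pre- and postprocessing channels are \<open>C \<rightarrow> SA\<close> and \<open>SB \<rightarrow> D\<close>: the memory is the left
  tensor factor, so that it does not separate \<open>A\<close> and \<open>B\<close> from a reference on the right.\<close>

record superchannel =
  mem_dim :: nat
  pre :: "complex mat \<Rightarrow> complex mat"
  post :: "complex mat \<Rightarrow> complex mat"

definition is_superchannel :: "nat \<Rightarrow> nat \<Rightarrow> nat \<Rightarrow> nat \<Rightarrow> superchannel \<Rightarrow> bool" where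
  "is_superchannel a b c d \<Theta> \<longleftrightarrow>
     pre \<Theta> \<in> channels c (mem_dim \<Theta> * a) \<and> post \<Theta> \<in> channels (mem_dim \<Theta> * b) d"

text \<open>\<open>super_apply a b c d r \<Theta> N\<close> is \<open>(\<Theta> \<otimes> id\<^sub>R)(N)\<close>, a channel \<open>CR \<rightarrow> DR\<close>, for a channel \<open>N\<close> from
  \<open>AR\<close> to \<open>BR\<close>; the intermediate systems are \<open>SAR\<close> and \<open>SBR\<close>.\<close>

definition super_apply :: "nat \<Rightarrow> nat \<Rightarrow> nat \<Rightarrow> nat \<Rightarrow> nat \<Rightarrow> superchannel \<Rightarrow>
    (complex mat \<Rightarrow> complex mat) \<Rightarrow> complex mat \<Rightarrow> complex mat" where
  "super_apply a b c d r \<Theta> N =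
     amp 1 (mem_dim \<Theta> * b) d r (post \<Theta>)
     \<circ> amp (mem_dim \<Theta>) (a * r) (b * r) 1 N
     \<circ> amp 1 c (mem_dim \<Theta> * a) r (pre \<Theta>)"

text \<open>\<open>N \<circ> F\<close> for \<open>F : C \<rightarrow> R'A\<close>, a channel \<open>CR \<rightarrow> R'BR\<close>.\<close>

definition insert_channel :: "nat \<Rightarrow> nat \<Rightarrow> nat \<Rightarrow> nat \<Rightarrow> nat \<Rightarrow>
    (complex mat \<Rightarrow> complex mat) \<Rightarrow> (complex mat \<Rightarrow> complex mat) \<Rightarrow> complex mat \<Rightarrow> complex mat" where
  "insert_channel a b c r r' F N = amp r' (a * r) (b * r) 1 N \<circ> amp 1 c (r' * a) r F"

text \<open>\<open>i\<close> is the dimension of the common input of \<open>N'\<close> and \<open>M'\<close>, the barred channels.\<close>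

definition fully_amortized_div ::
  "(complex mat \<Rightarrow> complex mat \<Rightarrow> ereal) \<Rightarrow> nat \<Rightarrow> nat \<Rightarrow> nat \<Rightarrow> nat \<Rightarrow>
   superchannel \<Rightarrow> superchannel \<Rightarrow> ereal" where
  "fully_amortized_div D a b c d \<Theta>\<^sub>1 \<Theta>\<^sub>2 =
     Sup {Inf {div_diff
                 (amortized_div D i (d * r)
                    (super_apply a b c d r \<Theta>\<^sub>1 N \<circ> N') (super_apply a b c d r \<Theta>\<^sub>2 M \<circ> M'))
                 (amortized_div D i (r' * b * r)
                    (insert_channel a b c r r' F N \<circ> N') (insert_channel a b c r r' F M \<circ> M'))
              | r' F. F \<in> channels c (r' * a)}
          | i r N M N' M'.
            N \<in> channels (a * r) (b * r) \<and> M \<in> channels (a * r) (b * r)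
            \<and> N' \<in> channels i (c * r) \<and> M' \<in> channels i (c * r)}"

section \<open>Adaptive strategies\<close>

text \<open>\<open>Pre j\<close> and \<open>Post j\<close> stand for the two component channels of the \<open>j\<close>-th copy,
  \<open>j < n\<close>. Components are listed in the order of their use, with indices starting at 0.\<close>

datatype component = Pre nat | Post nat

definition valid_order :: "nat \<Rightarrow> component list \<Rightarrow> bool" where
  "valid_order n T \<longleftrightarrow>
     distinct T \<and> set T = Pre ` {..<n} \<union> Post ` {..<n}
     \<and> (\<forall>j<n. \<forall>k<length T. \<forall>m<length T. T ! k = Pre j \<and> T ! m = Post j \<longrightarrow> k < m)"

fun in_dim :: "nat \<Rightarrow> nat \<Rightarrow> component \<Rightarrow> nat" where
  "in_dim b c (Pre j) = c"
| "in_dim b c (Post j) = b"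

fun out_dim :: "nat \<Rightarrow> nat \<Rightarrow> component \<Rightarrow> nat" where
  "out_dim a d (Pre j) = a"
| "out_dim a d (Post j) = d"

text \<open>The copies whose memory system is in existence after the components \<open>ts\<close> were applied, in
  the order in which these systems were created.\<close>

definition open_mems :: "component list \<Rightarrow> nat list" where
  "open_mems ts = [j. Pre j \<leftarrow> ts, Post j \<notin> set ts]"

text \<open>\<open>swap_mid l p q r\<close> takes operators on \<open>LPQR\<close> to operators on \<open>LQPR\<close>.\<close>

definition swap_mid :: "nat \<Rightarrow> nat \<Rightarrow> nat \<Rightarrow> nat \<Rightarrow> complex mat \<Rightarrow> complex mat" where
  "swap_mid l p q r X =
     (let f = (\<lambda>i. ((i div (p * q * r) * p + i div r mod p) * q + i div (p * r) mod q) * r + i mod r)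
      in mat (l * q * p * r) (l * q * p * r) (\<lambda>(i, j). X $$ (f i, f j)))"

text \<open>
  Between any two steps the whole system is \<open>S\<^sub>1 \<dots> S\<^sub>m X R\<close>, where \<open>S\<^sub>1 \<dots> S\<^sub>m\<close> are the memory systems
  in existence, in the order of \<^const>\<open>open_mems\<close>, \<open>X\<close> is the system (\<open>A\<close>, \<open>B\<close>, \<open>C\<close> or \<open>D\<close>) of the
  adjacent component, and \<open>R\<close> is everything else, of dimension \<open>r\<close>.
  \<open>Pre j\<close> adds a new memory system next to \<open>X\<close>; for \<open>Post j\<close> the memory system of copy \<open>j\<close> is first
  moved past the more recent ones. \<open>ts\<close> are the components applied earlier.
\<close>

definition apply_component :: "nat \<Rightarrow> nat \<Rightarrow> nat \<Rightarrow> nat \<Rightarrow> superchannel \<Rightarrow> nat \<Rightarrow> component list \<Rightarrow>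
    component \<Rightarrow> complex mat \<Rightarrow> complex mat" where
  "apply_component a b c d \<Theta> r ts t X =
     (let s = mem_dim \<Theta>; ms = open_mems ts in
      case t of
        Pre j \<Rightarrow> amp (s ^ length ms) c (s * a) r (pre \<Theta>) X
      | Post j \<Rightarrow>
          (let p = length (takeWhile (\<lambda>j'. j' \<noteq> j) ms); q = length ms - 1 - p in
           amp (s ^ (p + q)) (s * b) d r (post \<Theta>) (swap_mid (s ^ p) s (s ^ q) (b * r) X)))"

text \<open>\<open>ref_dim k\<close> is the dimension of \<open>R\<close> while the \<open>k\<close>-th component acts; the interjected channels may
  change it arbitrarily. The outcomes of the POVM \<open>povm 0, povm 1\<close> are 0 and 1.\<close>

record strategy =
  comp_order :: "component list"
  ref_dim :: "nat \<Rightarrow> nat"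
  init :: "complex mat"
  inter :: "nat \<Rightarrow> complex mat \<Rightarrow> complex mat"
  povm :: "nat \<Rightarrow> complex mat"

definition adaptive_strategy :: "nat \<Rightarrow> nat \<Rightarrow> nat \<Rightarrow> nat \<Rightarrow> nat \<Rightarrow> strategy \<Rightarrow> bool" where
  "adaptive_strategy a b c d n \<S> \<longleftrightarrow>
     (let T = comp_order \<S>; r = ref_dim \<S>; e = d * r (2 * n - 1) in
      valid_order n T
      \<and> init \<S> \<in> states (c * r 0)
      \<and> (\<forall>k < 2 * n - 1.
           inter \<S> k \<in> channels (out_dim a d (T ! k) * r k) (in_dim b c (T ! Suc k) * r (Suc k)))
      \<and> psd e (povm \<S> 0) \<and> psd e (povm \<S> 1) \<and> povm \<S> 0 + povm \<S> 1 = 1\<^sub>m e)"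

text \<open>\<open>strategy_state a b c d \<S> \<Theta> k\<close> is the state directly after the \<open>k\<close>-th component.\<close>

primrec strategy_state :: "nat \<Rightarrow> nat \<Rightarrow> nat \<Rightarrow> nat \<Rightarrow> strategy \<Rightarrow> superchannel \<Rightarrow> nat \<Rightarrow> complex mat"
  where
  "strategy_state a b c d \<S> \<Theta> 0 =
     apply_component a b c d \<Theta> (ref_dim \<S> 0) [] (comp_order \<S> ! 0) (init \<S>)"
| "strategy_state a b c d \<S> \<Theta> (Suc k) =
     (let T = comp_order \<S>; r = ref_dim \<S>; ts = take (Suc k) T in
      apply_component a b c d \<Theta> (r (Suc k)) ts (T ! Suc k)
        (amp (mem_dim \<Theta> ^ length (open_mems ts))
           (out_dim a d (T ! k) * r k) (in_dim b c (T ! Suc k) * r (Suc k)) 1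
           (inter \<S> k) (strategy_state a b c d \<S> \<Theta> k)))"

definition decision_dist :: "nat \<Rightarrow> nat \<Rightarrow> nat \<Rightarrow> nat \<Rightarrow> nat \<Rightarrow> strategy \<Rightarrow> superchannel \<Rightarrow> complex mat" where
  "decision_dist a b c d n \<S> \<Theta> =
     mat_diag 2 (\<lambda>x. tr (povm \<S> x * strategy_state a b c d \<S> \<Theta> (2 * n - 1)))"

end

theory Submission
  imports Defs
begin

text \<open>
  The copies are removed one at a time, in a setting where every copy may carry its own superchannel.
  Take the discriminated copy whose postprocessing comes last. Its preprocessing splits the strategy
  into a channel \<open>N'\<close> before it and a channel \<open>N\<close> between its two components, both containing parts
  of the other copies, and the state after its postprocessing is \<open>\<Theta>(N) \<circ> N'\<close>. What follows is the same
  for both superchannels, so data processing discards it. The infimum over \<open>F\<close> in the definition of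
  \<^const>\<open>fully_amortized_div\<close> then compares \<open>\<Theta>(N) \<circ> N'\<close> with \<open>N \<circ> F \<circ> N'\<close>, and for every \<open>F\<close> the
  latter is the same strategy with the copy replaced by the fixed preprocessing \<open>F\<close>, to which the
  induction hypothesis applies. The strategy is treated as a channel acting on its initial state, so
  that without any discriminated copy left the amortized divergence is at most 0.
\<close>

section \<open>Positive semidefinite matrices\<close>

text \<open>A copy reduced to a preprocessing \<open>F\<close> has a memory dimension of its own, so
  the strategies met in the induction mix superchannels with different memories even though the
  discriminated copies are all alike.

  The main obstacle is the reference system. The definition of \<open>fully_amortized_div\<close>
  asks for a single dimension, the same at both ends of \<open>N\<close> and of \<open>M\<close>.
  The actual reference of a copy consists of the reference of the strategy and the memories of all
  other open copies. Its dimension changes between the two components, and at the first one it may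
  differ between the two sides, since other discriminated copies may be open there. Everything is
  therefore embedded by zero padding into a common multiple of these dimensions and recovered by a
  partial trace.

  Choosing the last postprocessing has a further effect: every memory still open after it belongs to
  a copy that is the same on both sides, so the dimensions agree again and one and the same channel
  can be used in data processing.

  Strategies may interleave the copies arbitrarily, so memories must be moved past each other; these
  permutations are computed on the digits of matrix indices.\<close>

lemma psd_iff_quadratic_form:
  "psd d X \<longleftrightarrow> X \<in> carrier_mat d d \<and>
     (\<forall>f::nat \<Rightarrow> complex. 0 \<le> (\<Sum>i<d. \<Sum>j<d. X $$ (i, j) * f j * cnj (f i)))"
proof (cases "X \<in> carrier_mat d d")
  case True
  have *: "(X *\<^sub>v vec d f) \<bullet>c vec d f = (\<Sum>i<d. \<Sum>j<d. X $$ (i, j) * f j * cnj (f i))" for f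
    using True by (auto simp: scalar_prod_def sum_distrib_right atLeast0LessThan intro!: sum.cong)
  have "(\<forall>v \<in> carrier_vec d. 0 \<le> (X *\<^sub>v v) \<bullet>c v) \<longleftrightarrow> (\<forall>f. 0 \<le> (X *\<^sub>v vec d f) \<bullet>c vec d f)"
  proof safe
    fix v :: "complex vec" assume "\<forall>f. 0 \<le> (X *\<^sub>v vec d f) \<bullet>c vec d f" "v \<in> carrier_vec d"
    moreover have "v = vec d (\<lambda>i. v $ i)" using \<open>v \<in> carrier_vec d\<close> by auto
    ultimately show "0 \<le> (X *\<^sub>v v) \<bullet>c v" by metis
  qed auto
  then show ?thesis using True unfolding psd_def * by simp
qed (simp add: psd_def)

lemma psd_carrier: "psd d X \<Longrightarrow> X \<in> carrier_mat d d"
  by (simp add: psd_def)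

text \<open>The form of the new matrix at \<open>f\<close> is the form of \<open>X\<close> at the
  push-forward \<open>w\<close> of \<open>f\<close> along \<open>g\<close>, so \<open>g\<close> need
  not be injective. The predicate \<open>P\<close> serves zero padding; the map \<open>g\<close>
  serves permutations of tensor factors and the blocks summed in a partial trace.\<close>

lemma psd_reindex:
  assumes X: "psd d X" and g: "\<And>i. i < n \<Longrightarrow> P i \<Longrightarrow> g i < d"
  shows "psd n (mat n n (\<lambda>(i, j). if P i \<and> P j then X $$ (g i, g j) else 0))" (is "psd n ?Y")
  unfolding psd_iff_quadratic_form
proof (intro conjI allI)
  fix f :: "nat \<Rightarrow> complex"
  let ?I = "{i. i < n \<and> P i}"
  define w where "w k = (\<Sum>i\<in>{i\<in>?I. g i = k}. f i)" for k
  have fin: "finite ?I" by simp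
  have sub: "g ` ?I \<subseteq> {..<d}" using g by auto
  have grp: "(\<Sum>i\<in>?I. h (g i) * f i) = (\<Sum>k<d. h k * w k)"
    "(\<Sum>i\<in>?I. h (g i) * cnj (f i)) = (\<Sum>k<d. h k * cnj (w k))" for h
    using sum.group[OF fin _ sub, of "\<lambda>i. h (g i) * f i"]
      sum.group[OF fin _ sub, of "\<lambda>i. h (g i) * cnj (f i)"]
    by (auto simp: w_def sum_distrib_left intro!: sum.cong)
  have "(\<Sum>i<n. \<Sum>j<n. ?Y $$ (i, j) * f j * cnj (f i))
      = (\<Sum>i\<in>?I. \<Sum>j\<in>?I. X $$ (g i, g j) * f j * cnj (f i))"
    by (intro sum.mono_neutral_cong_right ballI) (auto intro!: sum.neutral sum.mono_neutral_cong_right)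
  also have "\<dots> = (\<Sum>i\<in>?I. (\<Sum>l<d. X $$ (g i, l) * w l) * cnj (f i))"
  proof (rule sum.cong[OF refl])
    fix i
    show "(\<Sum>j\<in>?I. X $$ (g i, g j) * f j * cnj (f i)) = (\<Sum>l<d. X $$ (g i, l) * w l) * cnj (f i)"
      using grp(1)[of "\<lambda>l. X $$ (g i, l)"] sum_distrib_right[of "\<lambda>j. X $$ (g i, g j) * f j" ?I "cnj (f i)"]
      by metis
  qed
  also have "\<dots> = (\<Sum>k<d. (\<Sum>l<d. X $$ (k, l) * w l) * cnj (w k))"
    by (rule grp(2)[of "\<lambda>k. \<Sum>l<d. X $$ (k, l) * w l"])
  also have "\<dots> \<ge> 0"
    using X by (simp add: psd_iff_quadratic_form sum_distrib_right)
  finally show "0 \<le> (\<Sum>i<n. \<Sum>j<n. ?Y $$ (i, j) * f j * cnj (f i))" .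
qed simp

lemma psd_sum:
  assumes "\<And>t. t < m \<Longrightarrow> psd d (X t)"
  shows "psd d (mat d d (\<lambda>(i, j). \<Sum>t<m. X t $$ (i, j)))"
  unfolding psd_iff_quadratic_form
proof (intro conjI allI)
  fix f :: "nat \<Rightarrow> complex"
  have "(\<Sum>i<d. \<Sum>j<d. (\<Sum>t<m. X t $$ (i, j)) * f j * cnj (f i))
      = (\<Sum>t<m. \<Sum>i<d. \<Sum>j<d. X t $$ (i, j) * f j * cnj (f i))"
    by (simp add: sum_distrib_right sum.swap[of _ "{..<m}"])
  also have "\<dots> \<ge> 0"
    using assms by (auto simp: psd_iff_quadratic_form intro: sum_nonneg[of "{..<m}"])
  finally show "0 \<le> (\<Sum>i<d. \<Sum>j<d. mat d d (\<lambda>(i, j). \<Sum>t<m. X t $$ (i, j)) $$ (i, j) * f j * cnj (f i))"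
    by simp
qed simp

text \<open>Index sets are arbitrary so that an induction can discard one index at a time.\<close>

definition psd_on :: "nat set \<Rightarrow> (nat \<Rightarrow> nat \<Rightarrow> complex) \<Rightarrow> bool" where
  "psd_on S M \<longleftrightarrow> (\<forall>f::nat \<Rightarrow> complex. 0 \<le> (\<Sum>i\<in>S. \<Sum>j\<in>S. M i j * f j * cnj (f i)))"

lemma psd_on_subset:
  assumes "psd_on T M" "S \<subseteq> T" "finite T"
  shows "psd_on S M"
  unfolding psd_on_def
proof
  fix f :: "nat \<Rightarrow> complex"
  let ?g = "\<lambda>i. if i \<in> S then f i else 0"
  have "(\<Sum>i\<in>S. \<Sum>j\<in>S. M i j * f j * cnj (f i)) = (\<Sum>i\<in>T. \<Sum>j\<in>T. M i j * ?g j * cnj (?g i))"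
    using assms(2,3)
    by (intro sum.mono_neutral_cong_left ballI) (auto intro!: sum.neutral sum.mono_neutral_cong_left)
  then show "0 \<le> (\<Sum>i\<in>S. \<Sum>j\<in>S. M i j * f j * cnj (f i))"
    using assms(1) by (simp only: psd_on_def)
qed

lemma psd_on_diag: "psd_on S M \<Longrightarrow> finite S \<Longrightarrow> a \<in> S \<Longrightarrow> 0 \<le> M a a"
  using psd_on_subset[of S M "{a}"] by (auto simp: psd_on_def dest: spec[where x="\<lambda>_. 1"])

lemma psd_on_pair:
  assumes "psd_on S M" "finite S" "a \<in> S" "b \<in> S" "a \<noteq> b"
  shows "0 \<le> M a a * x * cnj x + M a b * y * cnj x + M b a * x * cnj y + M b b * y * cnj y"
proof -
  have "psd_on {a, b} M" using assms psd_on_subset by auto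
  then show ?thesis using assms(5)
    by (auto simp: psd_on_def algebra_simps dest!: spec[where x="\<lambda>i. if i = a then x else y"])
qed

lemma psd_on_hermitian:
  assumes "psd_on S M" "finite S" "a \<in> S" "b \<in> S"
  shows "M b a = cnj (M a b)"
proof (cases "a = b")
  case True
  then show ?thesis using psd_on_diag[OF assms(1,2,3)] by (simp add: less_eq_complex_def complex_eq_iff)
next
  case False
  note * = psd_on_pair[OF assms False]
  \<comment> \<open>The form is real at (1, 1), which relates the imaginary parts of the two
    entries, and at (1, i), which relates their real parts.\<close>
  show ?thesis
    using *[of 1 1] *[of 1 \<i>] psd_on_diag[OF assms(1,2,3)] psd_on_diag[OF assms(1,2,4)]
    by (simp add: less_eq_complex_def complex_eq_iff)
qed

lemma psd_on_zero_diag: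
  assumes "psd_on S M" "finite S" "a \<in> S" "b \<in> S" "M a a = 0"
  shows "M a b = 0"
proof (cases "a = b")
  case False
  note * = psd_on_pair[OF assms(1-4) False]
  let ?z = "M a b" and ?t = "Re (M b b)"
  have ba: "M b a = cnj ?z" by (rule psd_on_hermitian[OF assms(1-4)])
  \<comment> \<open>With a vanishing diagonal entry at \<open>a\<close> the form at
    \<open>(- s * ?z, 1)\<close> is affine in \<open>s\<close>. Unless \<open>?z = 0\<close>, the
    value of \<open>s\<close> inserted below makes it -1.\<close>
  have "0 \<le> Re (M b b) - 2 * s * (cmod ?z)\<^sup>2" for s :: real
    using *[of "- of_real s * ?z" 1] assms(5) ba
    unfolding cmod_power2 by (simp add: less_eq_complex_def algebra_simps power2_eq_square)
  from this[of "(?t + 1) / (2 * (cmod ?z)\<^sup>2)"] show ?thesis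
    by (cases "?z = 0") (auto simp: field_simps)
qed (use assms in simp)

text \<open>The induction is Cholesky's algorithm: split off the rank one matrix built from a column with
  nonzero diagonal entry; a vanishing diagonal entry forces its row and column to vanish.\<close>

lemma trace_prod_psd_nonneg:
  assumes "finite S" "psd_on S M" "psd_on S Z"
  shows "0 \<le> (\<Sum>i\<in>S. \<Sum>j\<in>S. M i j * Z j i)"
  using assms
proof (induction S arbitrary: M rule: finite_induct)
  case (insert a S)
  have fin: "finite (insert a S)" using insert.hyps by simp
  have ZS: "psd_on S Z" using insert psd_on_subset[OF _ _ fin] by blast
  have drop: "0 \<le> (\<Sum>i\<in>insert a S. \<Sum>j\<in>insert a S. M' i j * Z j i)"
    if M': "psd_on S M'" "\<And>i. i \<in> insert a S \<Longrightarrow> M' a i = 0 \<and> M' i a = 0" for M'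
  proof -
    have "(\<Sum>i\<in>insert a S. \<Sum>j\<in>insert a S. M' i j * Z j i) = (\<Sum>i\<in>S. \<Sum>j\<in>S. M' i j * Z j i)"
      using insert.hyps M'(2) by (simp add: sum.distrib)
    then show ?thesis using insert.IH[OF M'(1) ZS] by simp
  qed
  show ?case
  proof (cases "M a a = 0")
    case True
    have "M a i = 0 \<and> M i a = 0" if "i \<in> insert a S" for i
      using psd_on_zero_diag[OF insert.prems(1) fin _ that True]
        psd_on_hermitian[OF insert.prems(1) fin _ that, of a] by simp
    moreover have "psd_on S M" using insert.prems(1) psd_on_subset[OF _ _ fin] by blast
    ultimately show ?thesis by (intro drop) auto
  next
    case False
    define m where "m = M a a"
    have m: "0 < m" using psd_on_diag[OF insert.prems(1) fin, of a] False m_def by (simp add: order_less_le)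
    have cm: "cnj m = m" using m by (simp add: less_complex_def complex_eq_iff)
    have her: "M a i = cnj (M i a)" if "i \<in> insert a S" for i
      using psd_on_hermitian[OF insert.prems(1) fin that, of a] by simp
    define M' where "M' i j = M i j - M i a * cnj (M j a) / m" for i j
    have "psd_on S M'"
      unfolding psd_on_def
    proof
      fix f :: "nat \<Rightarrow> complex"
      define s where "s = (\<Sum>j\<in>S. cnj (M j a) * f j)"
      \<comment> \<open>This value at \<open>a\<close> completes the square: the form of
        \<open>M\<close> at \<open>h\<close> is the form of the Schur complement \<open>M'\<close>
        at \<open>f\<close>.\<close>
      define h where "h = f(a := - s / m)"
      have hS: "(\<Sum>j\<in>S. g j (h j)) = (\<Sum>j\<in>S. g j (f j))" for g :: "nat \<Rightarrow> complex \<Rightarrow> complex"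
        unfolding h_def using insert.hyps by (intro sum.cong) auto
      have cs: "cnj s = (\<Sum>j\<in>S. M j a * cnj (f j))" by (simp add: s_def)
      let ?Q = "\<Sum>i\<in>S. \<Sum>j\<in>S. M i j * f j * cnj (f i)"
      have sa: "(\<Sum>j\<in>S. M a j * f j) = s"
        unfolding s_def by (intro sum.cong) (auto simp: her)
      have "0 \<le> (\<Sum>i\<in>insert a S. \<Sum>j\<in>insert a S. M i j * h j * cnj (h i))"
        using insert.prems(1) unfolding psd_on_def by blast
      also have "\<dots> = m * h a * cnj (h a) + (\<Sum>j\<in>S. M a j * f j) * cnj (h a)
          + h a * (\<Sum>i\<in>S. M i a * cnj (f i)) + ?Q"
        using insert.hyps hS[of "\<lambda>j x. M a j * x * cnj (h a)"]
          hS[of "\<lambda>i x. M i a * h a * cnj x"] hS[of "\<lambda>i x. \<Sum>j\<in>S. M i j * h j * cnj x"]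
          hS[of "\<lambda>j x. M i j * x * cnj (f i)" for i]
        by (simp add: sum.distrib m_def sum_distrib_left sum_distrib_right mult_ac)
      also have "\<dots> = ?Q - s * cnj s / m"
        unfolding sa cs[symmetric] using m cm by (simp add: h_def field_simps)
      also have "\<dots> = (\<Sum>i\<in>S. \<Sum>j\<in>S. M' i j * f j * cnj (f i))"
        unfolding M'_def cs unfolding s_def
        by (simp add: algebra_simps sum_subtractf sum_distrib_left sum_distrib_right sum_divide_distrib)
      finally show "0 \<le> (\<Sum>i\<in>S. \<Sum>j\<in>S. M' i j * f j * cnj (f i))" .
    qed
    moreover have "M' a i = 0 \<and> M' i a = 0" if "i \<in> insert a S" for i
      using False her[OF that] cm m_def by (simp add: M'_def)
    ultimately have 1: "0 \<le> (\<Sum>i\<in>insert a S. \<Sum>j\<in>insert a S. M' i j * Z j i)" by (rule drop)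
    \<comment> \<open>The rank one part that was split off pairs with \<open>Z\<close> to the form
      of \<open>Z\<close> at column \<open>a\<close> of \<open>M\<close>, up to division by
      \<open>m\<close>.\<close>
    have 2: "0 \<le> (\<Sum>i\<in>insert a S. \<Sum>j\<in>insert a S. Z i j * M j a * cnj (M i a))"
      using insert.prems(2) unfolding psd_on_def by (elim allE[where x="\<lambda>i. M i a"])
    have div_nonneg: "0 \<le> z / m" if "0 \<le> z" for z
      using that m by (simp add: less_eq_complex_def less_complex_def Re_divide Im_divide)
    let ?T = "insert a S"
    have "(\<Sum>i\<in>?T. \<Sum>j\<in>?T. M i j * Z j i)
        = (\<Sum>i\<in>?T. \<Sum>j\<in>?T. M' i j * Z j i + Z j i * M i a * cnj (M j a) / m)"
      by (intro sum.cong refl) (simp add: M'_def algebra_simps)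
    also have "\<dots> = (\<Sum>i\<in>?T. \<Sum>j\<in>?T. M' i j * Z j i)
        + (\<Sum>i\<in>?T. \<Sum>j\<in>?T. Z j i * M i a * cnj (M j a)) / m"
      by (simp only: sum.distrib sum_divide_distrib)
    also have "(\<Sum>i\<in>?T. \<Sum>j\<in>?T. Z j i * M i a * cnj (M j a))
        = (\<Sum>j\<in>?T. \<Sum>i\<in>?T. Z j i * M i a * cnj (M j a))"
      by (rule sum.swap)
    finally have "(\<Sum>i\<in>?T. \<Sum>j\<in>?T. M i j * Z j i)
        = (\<Sum>i\<in>?T. \<Sum>j\<in>?T. M' i j * Z j i)
          + (\<Sum>j\<in>?T. \<Sum>i\<in>?T. Z j i * M i a * cnj (M j a)) / m" .
    moreover have "0 \<le> (\<Sum>j\<in>?T. \<Sum>i\<in>?T. Z j i * M i a * cnj (M j a)) / m"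
      using 2 by (rule div_nonneg)
    ultimately show ?thesis by (simp only: add_nonneg_nonneg[OF 1])
  qed
qed simp

lemma psd_imp_psd_on: "psd d X \<Longrightarrow> psd_on {..<d} (\<lambda>i j. X $$ (i, j))"
  by (simp add: psd_iff_quadratic_form psd_on_def)

section \<open>Reordering and extending systems\<close>

lemma digit_less: "i < p \<Longrightarrow> j < q \<Longrightarrow> i * q + j < p * (q::nat)"
  using mult_le_mono1[of "Suc i" p q] by simp

lemma digits_exist:
  fixes i :: nat
  assumes "i < p * q"
  obtains x y where "i = x * q + y" "x < p" "y < q"
proof
  have "0 < q" using assms by (cases q) auto
  then show "i mod q < q" by simp
  show "i div q < p" using assms by (simp add: less_mult_imp_div_less)
qed simp

lemma digit_div: "j < q \<Longrightarrow> (i * q + j) div q = (i::nat)"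
  and digit_mod: "j < q \<Longrightarrow> (i * q + j) mod q = (j::nat)"
  by auto

lemma div_prod: "(a::nat) div (b * c) = a div c div b"
  by (metis div_mult2_eq mult.commute)

lemma mod_prod: "(a::nat) mod (b * c) = (a div c mod b) * c + a mod c"
  by (metis add.commute mod_mult2_eq mult.commute)

text \<open>As rewrite rules these collect an index into the nested form
  \<open>(x * q + y) * r + z\<close>, from which \<open>digit_div\<close> and
  \<open>digit_mod\<close> strip the last digit.\<close>

lemmas horner = add_mult_distrib[symmetric] add.assoc[symmetric] mult.assoc[symmetric]

lemmas digit_simps = digit_div digit_mod div_prod mod_prod horner

text \<open>The middle digit of \<open>i\<close>, of radix \<open>e\<close>, gives way to the digit
  \<open>k\<close>, of radix \<open>d\<close>. Both \<open>amp\<close> and \<open>swap_mid\<close>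
  read their argument at transformed indices of this kind, so that identities between them reduce to
  identities between digits.\<close>

definition amp_idx :: "nat \<Rightarrow> nat \<Rightarrow> nat \<Rightarrow> nat \<Rightarrow> nat \<Rightarrow> nat" where
  "amp_idx d e r i k = (i div (e * r) * d + k) * r + i mod r"

definition swap_idx :: "nat \<Rightarrow> nat \<Rightarrow> nat \<Rightarrow> nat \<Rightarrow> nat" where
  "swap_idx p q r i = ((i div (q * p * r) * p + i div r mod p) * q + i div (p * r) mod q) * r + i mod r"

lemma amp_carrier [simp]: "amp l d e r \<Phi> X \<in> carrier_mat (l * e * r) (l * e * r)"
  and dim_amp [simp]: "dim_row (amp l d e r \<Phi> X) = l * e * r" "dim_col (amp l d e r \<Phi> X) = l * e * r"
  by (simp_all add: amp_def)

lemma amp_index: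
  "i < l * e * r \<Longrightarrow> j < l * e * r \<Longrightarrow> amp l d e r \<Phi> X $$ (i, j) =
    \<Phi> (mat d d (\<lambda>(k, m). X $$ (amp_idx d e r i k, amp_idx d e r j m))) $$ (i div r mod e, j div r mod e)"
  by (simp add: amp_def amp_idx_def)

lemma swap_mid_carrier [simp]: "swap_mid l p q r X \<in> carrier_mat (l * q * p * r) (l * q * p * r)"
  and dim_swap_mid [simp]: "dim_row (swap_mid l p q r X) = l * q * p * r"
    "dim_col (swap_mid l p q r X) = l * q * p * r"
  by (simp_all add: swap_mid_def)

lemma swap_mid_index:
  "i < l * q * p * r \<Longrightarrow> j < l * q * p * r \<Longrightarrow>
    swap_mid l p q r X $$ (i, j) = X $$ (swap_idx p q r i, swap_idx p q r j)"
  by (simp add: swap_mid_def swap_idx_def mult.commute)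

lemma amp_idx_less:
  assumes "i < l * e * r" "k < d"
  shows "amp_idx d e r i k < l * d * r"
proof -
  have "0 < r" using assms by (cases r) auto
  have "i div (e * r) < l" using assms(1) by (simp add: less_mult_imp_div_less mult.assoc)
  then show ?thesis unfolding amp_idx_def
    using assms \<open>0 < r\<close> by (intro digit_less) auto
qed

lemma amp_idx_digits: "x < e \<Longrightarrow> z < r \<Longrightarrow> amp_idx d e r ((y * e + x) * r + z) k = (y * d + k) * r + z"
  by (simp add: amp_idx_def digit_simps)

lemma swap_idx_less:
  assumes "i < l * q * p * r"
  shows "swap_idx p q r i < l * p * q * r"
proof -
  have "0 < r" "0 < p" "0 < q" using assms by (auto intro: ccontr)
  have "i div (q * p * r) < l" using assms by (simp add: less_mult_imp_div_less mult_ac)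
  then show ?thesis unfolding swap_idx_def
    using \<open>0 < r\<close> \<open>0 < p\<close> \<open>0 < q\<close> by (intro digit_less) auto
qed

lemma swap_idx_digits:
  "a < q \<Longrightarrow> b < p \<Longrightarrow> z < r \<Longrightarrow>
    swap_idx p q r (((y * q + a) * p + b) * r + z) = ((y * p + b) * q + a) * r + z"
  by (simp add: swap_idx_def digit_simps)

lemma swap_idx_swap_idx:
  assumes "i < l * q * p * r"
  shows "swap_idx q p r (swap_idx p q r i) = i"
proof -
  obtain t z where 1: "i = t * r + z" "t < l * q * p" "z < r" using assms by (rule digits_exist)
  obtain t' b where 2: "t = t' * p + b" "t' < l * q" "b < p" using 1(2) by (rule digits_exist)
  obtain y a where 3: "t' = y * q + a" "y < l" "a < q" using 2(2) by (rule digits_exist)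
  show ?thesis using 1 2 3 by (simp add: swap_idx_digits)
qed

lemma amp_cong:
  assumes "\<And>Y. Y \<in> carrier_mat d d \<Longrightarrow> \<Phi> Y = \<Psi> Y"
  shows "amp l d e r \<Phi> = amp l d e r \<Psi>"
  by (rule ext) (simp add: amp_def assms)

text \<open>Each block that \<open>\<Psi>\<close> receives is exactly one value of
  \<open>\<Phi>\<close>, provided that this value has the right size.\<close>

lemma amp_comp:
  assumes "\<And>Y. Y \<in> carrier_mat d d \<Longrightarrow> \<Phi> Y \<in> carrier_mat e e"
  shows "amp l e f r \<Psi> (amp l d e r \<Phi> X) = amp l d f r (\<lambda>Y. \<Psi> (\<Phi> Y)) X"
proof (rule eq_matI; simp)
  fix i j assume i: "i < l * f * r" and j: "j < l * f * r"
  have *: "amp_idx d e r (amp_idx e f r i k) k' = amp_idx d f r i k'"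
    "amp_idx e f r i k div r mod e = k" if k: "k < e" and i: "i < l * f * r" for i k k'
  proof -
    obtain t z where 1: "i = t * r + z" "t < l * f" "z < r" using i by (rule digits_exist)
    obtain y a where 2: "t = y * f + a" "y < l" "a < f" using 1(2) by (rule digits_exist)
    show "amp_idx d e r (amp_idx e f r i k) k' = amp_idx d f r i k'"
      "amp_idx e f r i k div r mod e = k"
      using 1 2 k by (simp_all add: amp_idx_digits digit_simps)
  qed
  let ?B = "mat d d (\<lambda>(k, m). X $$ (amp_idx d f r i k, amp_idx d f r j m))"
  have c: "\<Phi> ?B \<in> carrier_mat e e" by (rule assms) simp
  have "mat e e (\<lambda>(k, m). amp l d e r \<Phi> X $$ (amp_idx e f r i k, amp_idx e f r j m)) = \<Phi> ?B"
    using i j c by (intro eq_matI) (auto simp: amp_index amp_idx_less *)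
  then show "amp l e f r \<Psi> (amp l d e r \<Phi> X) $$ (i, j) = amp l d f r (\<lambda>Y. \<Psi> (\<Phi> Y)) X $$ (i, j)"
    using i j by (simp add: amp_index)
qed

lemma amp_amp:
  "amp l (l' * d * r') (l' * e * r') r (amp l' d e r' \<Phi>) X = amp (l * l') d e (r' * r) \<Phi> X"
proof (rule eq_matI; simp)
  fix i j assume "i < l * l' * e * (r' * r)" and "j < l * l' * e * (r' * r)"
  then have i: "i < l * (l' * e * r') * r" and j: "j < l * (l' * e * r') * r" by (simp_all add: mult_ac)
  let ?h = "\<lambda>i. i div r mod (l' * e * r')"
  have *: "amp_idx (l' * d * r') (l' * e * r') r i (amp_idx d e r' (?h i) k) = amp_idx d e (r' * r) i k
      \<and> ?h i div r' mod e = i div (r' * r) mod e \<and> ?h i < l' * e * r'"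
    if i: "i < l * (l' * e * r') * r" for i k
  proof -
    obtain t z where 1: "i = t * r + z" "t < l * (l' * e * r')" "z < r" using i by (rule digits_exist)
    obtain y a where 2: "t = y * (l' * e * r') + a" "y < l" "a < l' * e * r'" using 1(2) by (rule digits_exist)
    obtain a' w where 3: "a = a' * r' + w" "a' < l' * e" "w < r'" using 2(3) by (rule digits_exist)
    obtain v u where 4: "a' = v * e + u" "v < l'" "u < e" using 3(2) by (rule digits_exist)
    have h: "?h i = a" using 1 2 by (simp add: digit_div digit_mod)
    have "i = ((((y * l' + v) * e + u) * r') + w) * r + z"
      using 1 2 3 4 by (simp add: algebra_simps)
    then show ?thesis using 1(3) 2(3) 3(1,3) 4 unfolding amp_idx_def h
      by (simp add: digit_simps)
  qed
  have "mat d d (\<lambda>(k, m). mat (l' * d * r') (l' * d * r')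
       (\<lambda>(k, m). X $$ (amp_idx (l' * d * r') (l' * e * r') r i k, amp_idx (l' * d * r') (l' * e * r') r j m))
       $$ (amp_idx d e r' (?h i) k, amp_idx d e r' (?h j) m))
     = mat d d (\<lambda>(k, m). X $$ (amp_idx d e (r' * r) i k, amp_idx d e (r' * r) j m))"
    using i j by (intro eq_matI) (auto simp: * amp_idx_less)
  then show "amp l (l' * d * r') (l' * e * r') r (amp l' d e r' \<Phi>) X $$ (i, j) = amp (l * l') d e (r' * r) \<Phi> X $$ (i, j)"
    using i j * by (simp add: amp_index mult_ac)
qed


lemma digits4_exist:
  fixes i :: nat
  assumes "i < l * p * q * r"
  obtains y a b z where "i = ((y * p + a) * q + b) * r + z" "y < l" "a < p" "b < q" "z < r"
  using assms digits_exist by metis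

text \<open>The exchanged systems U and S lie to the left of the one acted on, with V in between, so
  the two operations concern different digits.\<close>

lemma swap_amp_right:
  "swap_mid l u s (v * e * r) (amp (l * u * s * v) d e r \<Phi> X)
    = amp (l * s * u * v) d e r \<Phi> (swap_mid l u s (v * d * r) X)"
proof (rule eq_matI; simp add: mult.assoc[symmetric])
  fix i j assume i: "i < l * s * u * v * e * r" and j: "j < l * s * u * v * e * r"
  have *: "k < d \<Longrightarrow> swap_idx u s (v * d * r) (amp_idx d e r i k) = amp_idx d e r (swap_idx u s (v * e * r) i) k"
      "swap_idx u s (v * e * r) i div r mod e = i div r mod e"
      "swap_idx u s (v * e * r) i < l * u * s * v * e * r"
    if i: "i < l * s * u * v * e * r" for i k
  proof -
    obtain t w x z where 1: "i = ((t * v + w) * e + x) * r + z" "t < l * s * u" "w < v" "x < e" "z < r"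
      using i by (rule digits4_exist)
    obtain t' b where 2: "t = t' * u + b" "t' < l * s" "b < u" using 1(2) by (rule digits_exist)
    obtain y a where 3: "t' = y * s + a" "y < l" "a < s" using 2(2) by (rule digits_exist)
    show "k < d \<Longrightarrow> swap_idx u s (v * d * r) (amp_idx d e r i k) = amp_idx d e r (swap_idx u s (v * e * r) i) k"
      "swap_idx u s (v * e * r) i div r mod e = i div r mod e"
      using 1 2 3 unfolding amp_idx_def swap_idx_def by (simp_all add: digit_simps)
    show "swap_idx u s (v * e * r) i < l * u * s * v * e * r"
      using swap_idx_less[of i l s u "v * e * r"] i by (simp add: mult.assoc)
  qed
  have "mat d d (\<lambda>(k, m). swap_mid l u s (v * d * r) X $$ (amp_idx d e r i k, amp_idx d e r j m))
    = mat d d (\<lambda>(k, m). X $$ (amp_idx d e r (swap_idx u s (v * e * r) i) k,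
        amp_idx d e r (swap_idx u s (v * e * r) j) m))"
    using i j amp_idx_less[of _ "l * s * u * v"]
    by (intro eq_matI) (auto simp: swap_mid_index mult.assoc[symmetric] *)
  then show "swap_mid l u s (v * e * r) (amp (l * u * s * v) d e r \<Phi> X) $$ (i, j)
    = amp (l * s * u * v) d e r \<Phi> (swap_mid l u s (v * d * r) X) $$ (i, j)"
    using i j by (simp add: amp_index swap_mid_index mult.assoc[symmetric] *)
qed


text \<open>Moved from the far left to the far right, U becomes part of the reference. This turns a
  general \<open>amp\<close> into one with nothing on the left, the form that occurs in
  \<open>channels\<close> and in \<open>super_apply\<close>.\<close>

lemma swap_amp_left:
  "swap_mid 1 u (e * r) 1 (amp u d e r \<Phi> X) = amp 1 d e (r * u) \<Phi> (swap_mid 1 u (d * r) 1 X)"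
proof (rule eq_matI; simp add: mult.assoc[symmetric])
  fix i j assume i: "i < e * r * u" and j: "j < e * r * u"
  have *: "k < d \<Longrightarrow> swap_idx u (d * r) (Suc 0) (amp_idx d e (r * u) i k) = amp_idx d e r (swap_idx u (e * r) (Suc 0) i) k"
      "i div (r * u) mod e = swap_idx u (e * r) (Suc 0) i div r mod e"
      "swap_idx u (e * r) (Suc 0) i < u * e * r"
    if i: "i < e * r * u" for i k
  proof -
    obtain t w where 1: "i = t * u + w" "t < e * r" "w < u"
      using i by (rule digits_exist)
    obtain x z where 2: "t = x * r + z" "x < e" "z < r" using 1(2) by (rule digits_exist)
    show "k < d \<Longrightarrow> swap_idx u (d * r) (Suc 0) (amp_idx d e (r * u) i k) = amp_idx d e r (swap_idx u (e * r) (Suc 0) i) k"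
      "i div (r * u) mod e = swap_idx u (e * r) (Suc 0) i div r mod e"
      using 1 2 unfolding amp_idx_def swap_idx_def by (simp_all add: digit_simps)
    show "swap_idx u (e * r) (Suc 0) i < u * e * r"
      using swap_idx_less[of i 1 "e * r" u 1] i by (simp add: mult.assoc)
  qed
  have "mat d d (\<lambda>(k, m). swap_mid 1 u (d * r) 1 X $$ (amp_idx d e (r * u) i k, amp_idx d e (r * u) j m))
    = mat d d (\<lambda>(k, m). X $$ (amp_idx d e r (swap_idx u (e * r) (Suc 0) i) k,
        amp_idx d e r (swap_idx u (e * r) (Suc 0) j) m))"
    using i j amp_idx_less[of _ 1 e "r * u"]
    by (intro eq_matI) (auto simp: swap_mid_index mult.assoc[symmetric] *)
  then show "swap_mid (Suc 0) u (e * r) (Suc 0) (amp u d e r \<Phi> X) $$ (i, j)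
    = amp (Suc 0) d e (r * u) \<Phi> (swap_mid (Suc 0) u (d * r) (Suc 0) X) $$ (i, j)"
    using i j by (simp add: amp_index swap_mid_index mult.assoc[symmetric] *)
qed

lemma amp_swap_mid:
  "amp l' (l * p * q * r) (l * q * p * r) k (swap_mid l p q r) X = swap_mid (l' * l) p q (r * k) X"
proof (rule eq_matI; simp add: mult.assoc[symmetric])
  fix i j assume i: "i < l' * l * q * p * r * k" and j: "j < l' * l * q * p * r * k"
  have *: "amp_idx (l * p * q * r) (l * q * p * r) k i (swap_idx p q r (i div k mod (l * q * p * r)))
        = swap_idx p q (r * k) i"
      "i div k mod (l * q * p * r) < l * q * p * r"
    if i: "i < l' * l * q * p * r * k" for i
  proof -
    obtain t x y w where 1: "i = ((t * p + x) * r + y) * k + w" "t < l' * l * q" "x < p" "y < r" "w < k"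
      using i by (rule digits4_exist)
    obtain t' z where 2: "t = t' * q + z" "t' < l' * l" "z < q" using 1(2) by (rule digits_exist)
    obtain a b where 3: "t' = a * l + b" "a < l'" "b < l" using 2(2) by (rule digits_exist)
    show "amp_idx (l * p * q * r) (l * q * p * r) k i (swap_idx p q r (i div k mod (l * q * p * r)))
        = swap_idx p q (r * k) i"
      using 1 2 3 unfolding amp_idx_def swap_idx_def by (simp add: digit_simps)
    show "i div k mod (l * q * p * r) < l * q * p * r"
      using 1 2 3 by (auto intro!: mod_less_divisor)
  qed
  show "amp l' (l * p * q * r) (l * q * p * r) k (swap_mid l p q r) X $$ (i, j)
    = swap_mid (l' * l) p q (r * k) X $$ (i, j)"
    using i j by (simp add: amp_index swap_mid_index mult.assoc[symmetric] * swap_idx_less)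
qed

lemma swap_mid_swap_mid:
  assumes "l * q * p * r = l' * p' * q' * r'"
  shows "swap_mid l' p' q' r' (swap_mid l p q r X)
    = mat (l' * q' * p' * r') (l' * q' * p' * r')
        (\<lambda>(i, j). X $$ (swap_idx p q r (swap_idx p' q' r' i), swap_idx p q r (swap_idx p' q' r' j)))"
  using swap_idx_less[of _ l' q' p' r'] by (intro eq_matI) (auto simp: swap_mid_index assms)

lemma swap_mid_inverse:
  assumes "X \<in> carrier_mat (l * p * q * r) (l * p * q * r)"
  shows "swap_mid l q p r (swap_mid l p q r X) = X"
  using assms by (intro eq_matI) (auto simp: swap_mid_swap_mid swap_idx_swap_idx)

text \<open>Both sides carry USVPQR to SUVQPR.\<close>

lemma swap_swap_right:
  "swap_mid 1 u s (v * q * p * r) (swap_mid (u * s * v) p q r X)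
    = swap_mid (s * u * v) p q r (swap_mid 1 u s (v * p * q * r) X)"
proof -
  have "swap_idx p q r (swap_idx u s (v * q * p * r) i) = swap_idx u s (v * p * q * r) (swap_idx p q r i)"
    if i: "i < s * u * v * q * p * r" for i
  proof -
    obtain t x y z where 1: "i = ((t * q + x) * p + y) * r + z" "t < s * u * v" "x < q" "y < p" "z < r"
      using i by (rule digits4_exist)
    obtain t' c where 2: "t = t' * v + c" "t' < s * u" "c < v" using 1(2) by (rule digits_exist)
    obtain a b where 3: "t' = a * u + b" "a < s" "b < u" using 2(2) by (rule digits_exist)
    show ?thesis using 1 2 3 unfolding swap_idx_def by (simp add: digit_simps)
  qed
  then show ?thesis
    by (subst (1 2) swap_mid_swap_mid) (auto intro!: eq_matI simp: mult_ac)
qed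

text \<open>Both sides carry UPWSVR to SUWVPR. Once S is in front, P has only WV to cross.\<close>

lemma swap_swap_left:
  "swap_mid 1 (u * w) s (v * p * r) (swap_mid u p (w * s * v) r X)
    = swap_mid (s * u) p (w * v) r (swap_mid 1 (u * p * w) s (v * r) X)"
proof -
  have "swap_idx p (w * s * v) r (swap_idx (u * w) s (v * p * r) i)
      = swap_idx (u * p * w) s (v * r) (swap_idx p (w * v) r i)"
    if i: "i < s * u * w * v * p * r" for i
  proof -
    obtain t x y z where 1: "i = ((t * v + x) * p + y) * r + z" "t < s * u * w" "x < v" "y < p" "z < r"
      using i by (rule digits4_exist)
    obtain t' c where 2: "t = t' * w + c" "t' < s * u" "c < w" using 1(2) by (rule digits_exist)
    obtain a b where 3: "t' = a * u + b" "a < s" "b < u" using 2(2) by (rule digits_exist)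
    show ?thesis using 1 2 3 unfolding swap_idx_def by (simp add: digit_simps)
  qed
  then show ?thesis
    by (subst (1 2) swap_mid_swap_mid) (auto intro!: eq_matI simp: mult_ac)
qed

text \<open>Both sides carry USVY to SYUV.\<close>

lemma swap_all_swap:
  "swap_mid 1 (u * v) (s * y) 1 (swap_mid u s v y X) = swap_mid s (u * v) y 1 (swap_mid 1 u s (v * y) X)"
proof -
  have "swap_idx s v y (swap_idx (u * v) (s * y) 1 i) = swap_idx u s (v * y) (swap_idx (u * v) y 1 i)"
    if i: "i < s * y * u * v" for i
  proof -
    obtain t x z w where 1: "i = ((t * y + x) * u + z) * v + w" "t < s" "x < y" "z < u" "w < v"
      using i by (rule digits4_exist)
    show ?thesis using 1 unfolding swap_idx_def by (simp add: digit_simps)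
  qed
  then show ?thesis
    by (subst (1 2) swap_mid_swap_mid) (auto intro!: eq_matI simp: mult_ac)
qed

text \<open>The detour through SYU puts U at the far right, where it can be treated as
  reference.\<close>

lemma swap_eq_swap_swap_all:
  "swap_mid 1 u s y X = swap_mid s y u 1 (swap_mid 1 u (s * y) 1 X)"
proof -
  have "swap_idx u s y i = swap_idx u (s * y) 1 (swap_idx y u 1 i)"
    if i: "i < s * u * y" for i
  proof -
    obtain t x where 1: "i = t * y + x" "t < s * u" "x < y" using i by (rule digits_exist)
    obtain a b where 2: "t = a * u + b" "a < s" "b < u" using 1(2) by (rule digits_exist)
    show ?thesis using 1 2 unfolding swap_idx_def by (simp add: digit_simps)
  qed
  then show ?thesis
    by (subst swap_mid_swap_mid) (auto intro!: eq_matI simp: mult_ac swap_mid_index)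
qed

section \<open>Channels\<close>

lemma sum_digits: "(\<Sum>i<a * b. f i) = (\<Sum>x<a. \<Sum>y<b. f (x * b + y :: nat))"
proof (induction a)
  case (Suc a)
  have eq: "{..<Suc a * b} = {..<a * b} \<union> {a * b..<a * b + b}" by auto
  have "(\<Sum>i<Suc a * b. f i) = (\<Sum>i<a * b. f i) + (\<Sum>i\<in>{a * b..<a * b + b}. f i)"
    unfolding eq by (rule sum.union_disjoint) auto
  also have "(\<Sum>i\<in>{a * b..<a * b + b}. f i) = (\<Sum>y<b. f (a * b + y))"
    using sum.shift_bounds_nat_ivl[of f 0 "a * b" b] by (simp add: atLeast0LessThan add.commute)
  finally show ?case using Suc by simp
qed simp

lemma channelI:
  assumes "0 < d" "0 < e"
    and "\<And>X. X \<in> carrier_mat d d \<Longrightarrow> \<Phi> X \<in> carrier_mat e e"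
    and "\<And>X Y. X \<in> carrier_mat d d \<Longrightarrow> Y \<in> carrier_mat d d \<Longrightarrow> \<Phi> (X + Y) = \<Phi> X + \<Phi> Y"
    and "\<And>X z. X \<in> carrier_mat d d \<Longrightarrow> \<Phi> (z \<cdot>\<^sub>m X) = z \<cdot>\<^sub>m \<Phi> X"
    and "\<And>k X. psd (d * k) X \<Longrightarrow> psd (e * k) (amp 1 d e k \<Phi> X)"
    and "\<And>X. X \<in> carrier_mat d d \<Longrightarrow> tr (\<Phi> X) = tr X"
  shows "\<Phi> \<in> channels d e"
  using assms by (simp add: channels_def)

lemma
  assumes "\<Phi> \<in> channels d e"
  shows channel_pos: "0 < d" "0 < e"
    and channel_carrier: "X \<in> carrier_mat d d \<Longrightarrow> \<Phi> X \<in> carrier_mat e e"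
    and channel_add: "X \<in> carrier_mat d d \<Longrightarrow> Y \<in> carrier_mat d d \<Longrightarrow> \<Phi> (X + Y) = \<Phi> X + \<Phi> Y"
    and channel_smult: "X \<in> carrier_mat d d \<Longrightarrow> \<Phi> (z \<cdot>\<^sub>m X) = z \<cdot>\<^sub>m \<Phi> X"
    and channel_amp_psd: "psd (d * k) X \<Longrightarrow> psd (e * k) (amp 1 d e k \<Phi> X)"
    and channel_tr: "X \<in> carrier_mat d d \<Longrightarrow> tr (\<Phi> X) = tr X"
  using assms by (simp_all add: channels_def)

lemma channel_zero:
  assumes "\<Phi> \<in> channels d e"
  shows "\<Phi> (0\<^sub>m d d) = 0\<^sub>m e e"
proof -
  have "0\<^sub>m d d = (0::complex) \<cdot>\<^sub>m 0\<^sub>m d d" by (intro eq_matI) auto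
  then have "\<Phi> (0\<^sub>m d d) = 0 \<cdot>\<^sub>m \<Phi> (0\<^sub>m d d)"
    using channel_smult[OF assms, of "0\<^sub>m d d" 0] by simp
  also have "\<dots> = 0\<^sub>m e e"
    using channel_carrier[OF assms, of "0\<^sub>m d d"] by (intro eq_matI) auto
  finally show ?thesis .
qed

lemma amp_trivial:
  assumes "X \<in> carrier_mat d d" "\<Phi> X \<in> carrier_mat e e"
  shows "amp 1 d e 1 \<Phi> X = \<Phi> X"
proof -
  have "mat d d (\<lambda>(k, m). X $$ (k, m)) = X" using assms(1) by auto
  then show ?thesis using assms(2) by (intro eq_matI) (auto simp: amp_index amp_idx_def)
qed

lemma channel_psd:
  assumes "\<Phi> \<in> channels d e" "psd d X"
  shows "psd e (\<Phi> X)"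
  using channel_amp_psd[OF assms(1), of 1 X] assms(2)
    amp_trivial[of X d \<Phi> e] channel_carrier[OF assms(1)] psd_carrier[OF assms(2)] by simp

lemma channel_states:
  assumes "\<Phi> \<in> channels d e" "\<rho> \<in> states d"
  shows "\<Phi> \<rho> \<in> states e"
  using assms channel_psd[OF assms(1)] channel_tr[OF assms(1)]
  by (auto simp: states_def dest: psd_carrier)

lemma swap_mid_psd:
  assumes "psd (l * p * q * r) X"
  shows "psd (l * q * p * r) (swap_mid l p q r X)"
proof -
  have "swap_mid l p q r X = mat (l * q * p * r) (l * q * p * r)
      (\<lambda>(i, j). if True \<and> True then X $$ (swap_idx p q r i, swap_idx p q r j) else 0)"
    by (intro eq_matI) (auto simp: swap_mid_index)
  then show ?thesis using psd_reindex[OF assms, of _ "\<lambda>_. True"] swap_idx_less by simp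
qed

lemma swap_mid_channel:
  assumes "0 < l" "0 < p" "0 < q" "0 < r"
  shows "swap_mid l p q r \<in> channels (l * p * q * r) (l * q * p * r)"
proof (rule channelI)
  fix X :: "complex mat" assume X: "X \<in> carrier_mat (l * p * q * r) (l * p * q * r)"
  have "bij_betw (swap_idx p q r) {..<l * q * p * r} {..<l * p * q * r}"
    by (rule bij_betw_byWitness[where f'="swap_idx q p r"])
      (auto simp: swap_idx_swap_idx swap_idx_less)
  then have "(\<Sum>i<l * q * p * r. X $$ (swap_idx p q r i, swap_idx p q r i)) = (\<Sum>i<l * p * q * r. X $$ (i, i))"
    by (rule sum.reindex_bij_betw)
  then show "tr (swap_mid l p q r X) = tr X" using X by (simp add: tr_def swap_mid_index)
next
  fix k X assume "psd (l * p * q * r * k) X"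
  then show "psd (l * q * p * r * k) (amp 1 (l * p * q * r) (l * q * p * r) k (swap_mid l p q r) X)"
    unfolding amp_swap_mid using swap_mid_psd[of l p q "r * k" X] by (simp add: mult.assoc)
qed (use assms in \<open>auto intro!: eq_matI simp: swap_mid_index swap_idx_less\<close>)

text \<open>The dimensions enter through equations, so that products bracketed or ordered
  differently can be matched by arithmetic. The same holds for \<open>amp_channel'\<close>.\<close>

lemma swap_mid_channel':
  assumes "n = l * p * q * r" "m = l * q * p * r" "0 < n"
  shows "swap_mid l p q r \<in> channels n m"
  using swap_mid_channel[of l p q r] assms by auto

text \<open>Complete positivity in \<open>channels\<close> speaks of a reference on the right only.
  The left system is moved there and back, and permutations of factors preserve positivity.\<close>

lemma amp_psd:
  assumes "\<Phi> \<in> channels d e" "psd (l * d * r) X"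
  shows "psd (l * e * r) (amp l d e r \<Phi> X)"
proof -
  have "amp l d e r \<Phi> X = swap_mid 1 (e * r) l 1 (swap_mid 1 l (e * r) 1 (amp l d e r \<Phi> X))"
    using swap_mid_inverse[of "amp l d e r \<Phi> X" 1 l "e * r" 1] by (simp add: mult.assoc[symmetric])
  also have "\<dots> = swap_mid 1 (e * r) l 1 (amp 1 d e (r * l) \<Phi> (swap_mid 1 l (d * r) 1 X))"
    by (simp only: swap_amp_left)
  finally have *: "amp l d e r \<Phi> X = \<dots>" .
  have "psd (1 * (d * r) * l * 1) (swap_mid 1 l (d * r) 1 X)"
    using assms(2) by (intro swap_mid_psd) (simp add: mult.assoc)
  then have "psd (e * (r * l)) (amp 1 d e (r * l) \<Phi> (swap_mid 1 l (d * r) 1 X))"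
    by (intro channel_amp_psd[OF assms(1)]) (simp add: mult.assoc)
  then have "psd (1 * l * (e * r) * 1) (swap_mid 1 (e * r) l 1 (amp 1 d e (r * l) \<Phi> (swap_mid 1 l (d * r) 1 X)))"
    by (intro swap_mid_psd) (simp add: mult.assoc)
  then show ?thesis unfolding * by (simp add: mult.assoc)
qed

text \<open>Only the blocks with equal row and column indices in both outer systems enter the trace,
  and \<open>\<Phi>\<close> preserves the trace of each of them.\<close>

lemma tr_amp:
  assumes "\<Phi> \<in> channels d e" "X \<in> carrier_mat (l * d * r) (l * d * r)"
  shows "tr (amp l d e r \<Phi> X) = tr X"
proof -
  let ?B = "\<lambda>y z. mat d d (\<lambda>(k, m). X $$ ((y * d + k) * r + z, (y * d + m) * r + z))"
  have B: "tr (\<Phi> (?B y z)) = tr (?B y z)" "dim_row (\<Phi> (?B y z)) = e" for y z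
    using channel_tr[OF assms(1), of "?B y z"] channel_carrier[OF assms(1), of "?B y z"] by auto
  have "tr (amp l d e r \<Phi> X) = (\<Sum>y<l. \<Sum>x<e. \<Sum>z<r. amp l d e r \<Phi> X $$ ((y * e + x) * r + z, (y * e + x) * r + z))"
    by (simp add: tr_def sum_digits)
  also have "\<dots> = (\<Sum>y<l. \<Sum>x<e. \<Sum>z<r. \<Phi> (?B y z) $$ (x, x))"
  proof (intro sum.cong refl)
    fix y x z assume "y \<in> {..<l}" "x \<in> {..<e}" "z \<in> {..<r}"
    then show "amp l d e r \<Phi> X $$ ((y * e + x) * r + z, (y * e + x) * r + z) = \<Phi> (?B y z) $$ (x, x)"
      by (simp add: amp_index amp_idx_digits digit_less digit_div digit_mod)
  qed
  also have "\<dots> = (\<Sum>y<l. \<Sum>z<r. tr (\<Phi> (?B y z)))"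
    by (simp add: tr_def B(2) sum.swap[of _ "{..<e}" "{..<r}"])
  also have "\<dots> = (\<Sum>y<l. \<Sum>z<r. \<Sum>x<d. X $$ ((y * d + x) * r + z, (y * d + x) * r + z))"
    unfolding B(1) by (simp add: tr_def)
  also have "\<dots> = (\<Sum>y<l. \<Sum>x<d. \<Sum>z<r. X $$ ((y * d + x) * r + z, (y * d + x) * r + z))"
    by (simp add: sum.swap[of _ "{..<r}" "{..<d}"])
  also have "\<dots> = tr X" using assms(2) by (simp add: tr_def sum_digits)
  finally show ?thesis .
qed

lemma amp_channel:
  assumes \<Phi>: "\<Phi> \<in> channels d e" and "0 < l" "0 < r"
  shows "amp l d e r \<Phi> \<in> channels (l * d * r) (l * e * r)"
proof (rule channelI)
  show "0 < l * d * r" "0 < l * e * r" using assms channel_pos[OF \<Phi>] by simp_all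
next
  fix X Y :: "complex mat"
  assume X: "X \<in> carrier_mat (l * d * r) (l * d * r)" and Y: "Y \<in> carrier_mat (l * d * r) (l * d * r)"
  show "amp l d e r \<Phi> (X + Y) = amp l d e r \<Phi> X + amp l d e r \<Phi> Y"
  proof (rule eq_matI; simp)
    fix i j assume i: "i < l * e * r" "j < l * e * r"
    let ?B = "\<lambda>X. mat d d (\<lambda>(k, m). X $$ (amp_idx d e r i k, amp_idx d e r j m))"
    have "?B (X + Y) = ?B X + ?B Y" using X Y i by (intro eq_matI) (auto simp: amp_idx_less)
    moreover have "i div r mod e < e" "j div r mod e < e" using channel_pos[OF \<Phi>] by simp_all
    ultimately show "amp l d e r \<Phi> (X + Y) $$ (i, j) = amp l d e r \<Phi> X $$ (i, j) + amp l d e r \<Phi> Y $$ (i, j)"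
      using i channel_carrier[OF \<Phi>, of "?B X"] channel_carrier[OF \<Phi>, of "?B Y"]
      by (simp add: amp_index channel_add[OF \<Phi>])
  qed
next
  fix X :: "complex mat" and z
  assume X: "X \<in> carrier_mat (l * d * r) (l * d * r)"
  show "amp l d e r \<Phi> (z \<cdot>\<^sub>m X) = z \<cdot>\<^sub>m amp l d e r \<Phi> X"
  proof (rule eq_matI; simp)
    fix i j assume i: "i < l * e * r" "j < l * e * r"
    let ?B = "\<lambda>X. mat d d (\<lambda>(k, m). X $$ (amp_idx d e r i k, amp_idx d e r j m))"
    have "?B (z \<cdot>\<^sub>m X) = z \<cdot>\<^sub>m ?B X" using X i by (intro eq_matI) (auto simp: amp_idx_less)
    moreover have "i div r mod e < e" "j div r mod e < e" using channel_pos[OF \<Phi>] by simp_all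
    ultimately show "amp l d e r \<Phi> (z \<cdot>\<^sub>m X) $$ (i, j) = z * amp l d e r \<Phi> X $$ (i, j)"
      using i channel_carrier[OF \<Phi>, of "?B X"]
      by (simp add: amp_index channel_smult[OF \<Phi>])
  qed
next
  fix k X assume "psd (l * d * r * k) X"
  then show "psd (l * e * r * k) (amp 1 (l * d * r) (l * e * r) k (amp l d e r \<Phi>) X)"
    unfolding amp_amp using amp_psd[OF \<Phi>, of l "r * k" X] by (simp add: mult.assoc)
qed (simp_all add: tr_amp[OF \<Phi>])

lemma amp_channel':
  assumes "\<Phi> \<in> channels d e" "n = l * d * r" "m = l * e * r" "0 < l" "0 < r"
  shows "amp l d e r \<Phi> \<in> channels n m"
  using amp_channel assms by simp

lemma comp_channel:
  assumes \<Phi>: "\<Phi> \<in> channels d e" and \<Psi>: "\<Psi> \<in> channels e f"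
  shows "\<Psi> \<circ> \<Phi> \<in> channels d f"
proof (rule channelI)
  fix k X assume "psd (d * k) X"
  then have "psd (f * k) (amp 1 e f k \<Psi> (amp 1 d e k \<Phi> X))"
    by (intro channel_amp_psd[OF \<Psi>] channel_amp_psd[OF \<Phi>])
  then show "psd (f * k) (amp 1 d f k (\<Psi> \<circ> \<Phi>) X)"
    by (subst (asm) amp_comp) (simp_all add: channel_carrier[OF \<Phi>] comp_def)
qed (use channel_pos[OF \<Phi>] channel_pos[OF \<Psi>] in \<open>simp_all add: channel_carrier[OF \<Phi>] channel_carrier[OF \<Psi>]
  channel_add[OF \<Phi>] channel_add[OF \<Psi>] channel_smult[OF \<Phi>] channel_smult[OF \<Psi>] channel_tr[OF \<Phi>] channel_tr[OF \<Psi>]\<close>)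

lemma channel_cong:
  assumes "\<Phi> \<in> channels d e" "\<And>X. X \<in> carrier_mat d d \<Longrightarrow> \<Phi> X = \<Psi> X"
  shows "\<Psi> \<in> channels d e"
  using assms amp_cong[of d \<Phi> \<Psi>] by (auto simp: channels_def)


text \<open>This is conjugation by the inclusion of the first \<open>z\<close> basis vectors. If
  \<open>n = q * z\<close>, it tensors on the left with the first basis state of a system of
  dimension \<open>q\<close>; the partial trace \<open>ptrace q z\<close> over that system undoes
  it.\<close>

definition pad_zero :: "nat \<Rightarrow> nat \<Rightarrow> complex mat \<Rightarrow> complex mat" where
  "pad_zero z n X = mat n n (\<lambda>(i, j). if i < z \<and> j < z then X $$ (i, j) else 0)"

definition ptrace :: "nat \<Rightarrow> nat \<Rightarrow> complex mat \<Rightarrow> complex mat" where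
  "ptrace q z X = mat z z (\<lambda>(i, j). \<Sum>t<q. X $$ (t * z + i, t * z + j))"

lemma ptrace_pad_zero:
  assumes "X \<in> carrier_mat z z" "0 < q"
  shows "ptrace q z (pad_zero z (q * z) X) = X"
proof (rule eq_matI)
  fix i j assume i: "i < dim_row X" "j < dim_col X"
  have "pad_zero z (q * z) X $$ (t * z + i, t * z + j) = (if t = 0 then X $$ (i, j) else 0)" if "t < q" for t
    using i assms(1) that digit_less[of t q i z] digit_less[of t q j z]
    by (cases t) (auto simp: pad_zero_def)
  then show "ptrace q z (pad_zero z (q * z) X) $$ (i, j) = X $$ (i, j)"
    using i assms by (simp add: ptrace_def)
qed (use assms in \<open>auto simp: ptrace_def\<close>)

lemma pad_zero_channel:
  assumes "0 < z" "z \<le> n"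
  shows "pad_zero z n \<in> channels z n"
proof (rule channelI)
  fix k X assume X: "psd (z * k) X"
  have "amp 1 z n k (pad_zero z n) X = mat (n * k) (n * k)
      (\<lambda>(i, j). if i < z * k \<and> j < z * k then X $$ (i, j) else 0)"
  proof (rule eq_matI; simp split del: if_split)
    fix i j assume i: "i < n * k" "j < n * k"
    obtain x w where 1: "i = x * k + w" "x < n" "w < k" using i(1) by (rule digits_exist)
    obtain y v where 2: "j = y * k + v" "y < n" "v < k" using i(2) by (rule digits_exist)
    have "x < z \<longleftrightarrow> i < z * k" "y < z \<longleftrightarrow> j < z * k"
      using 1 2 by (auto simp: digit_less) (metis digit_div less_mult_imp_div_less)+
    then show "amp (Suc 0) z n k (pad_zero z n) X $$ (i, j) =
        (if i < z * k \<and> j < z * k then X $$ (i, j) else 0)"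
      using i 1 2 by (simp add: amp_index pad_zero_def digit_div digit_mod amp_idx_def digit_simps)
  qed
  then show "psd (n * k) (amp 1 z n k (pad_zero z n) X)"
    using psd_reindex[OF X, of "n * k" "\<lambda>i. i < z * k" "\<lambda>i. i"] by simp
next
  fix X :: "complex mat" assume "X \<in> carrier_mat z z"
  then show "tr (pad_zero z n X) = tr X"
    using assms by (simp add: tr_def pad_zero_def) (rule sum.mono_neutral_cong_right; auto)
qed (use assms in \<open>auto simp: pad_zero_def intro!: eq_matI\<close>)

lemma ptrace_channel:
  assumes "0 < z" "0 < q"
  shows "ptrace q z \<in> channels (q * z) z"
proof (rule channelI)
  fix k X assume X: "psd (q * z * k) X"
  let ?Y = "\<lambda>t. mat (z * k) (z * k) (\<lambda>(i, j). if True \<and> True then X $$ (t * (z * k) + i, t * (z * k) + j) else 0)"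
  have "amp 1 (q * z) z k (ptrace q z) X = mat (z * k) (z * k) (\<lambda>(i, j). \<Sum>t<q. ?Y t $$ (i, j))"
  proof (rule eq_matI; simp)
    fix i j assume i: "i < z * k" "j < z * k"
    obtain x w where 1: "i = x * k + w" "x < z" "w < k" using i(1) by (rule digits_exist)
    obtain y v where 2: "j = y * k + v" "y < z" "v < k" using i(2) by (rule digits_exist)
    show "amp (Suc 0) (q * z) z k (ptrace q z) X $$ (i, j) =
        (\<Sum>t<q. X $$ (t * (z * k) + i, t * (z * k) + j))"
      using i 1 2 by (simp add: amp_index ptrace_def amp_idx_def digit_less digit_simps)
  qed
  note eq = this
  have "psd (z * k) (?Y t)" if "t < q" for t
    using X that digit_less[of t q _ "z * k"] by (intro psd_reindex) (auto simp: mult.assoc)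
  then show "psd (z * k) (amp 1 (q * z) z k (ptrace q z) X)"
    unfolding eq by (rule psd_sum)
next
  fix X :: "complex mat" assume "X \<in> carrier_mat (q * z) (q * z)"
  then show "tr (ptrace q z X) = tr X"
    by (simp add: tr_def ptrace_def sum_digits) (rule sum.swap)
qed (use assms in \<open>auto simp: ptrace_def digit_less sum.distrib sum_distrib_left intro!: eq_matI\<close>)

lemma channels_nonempty:
  assumes "0 < d" "0 < e"
  obtains \<Phi> where "\<Phi> \<in> channels d e"
proof
  \<comment> \<open>The full trace, followed by the preparation of the first basis state.\<close>
  show "pad_zero 1 e \<circ> ptrace d 1 \<in> channels d e"
    using comp_channel[OF ptrace_channel[of 1 d] pad_zero_channel[of 1 e]] assms by simp
qed

text \<open>The padding acts on the reference alone. Blocks outside the padded corner vanish, and a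
  channel maps them to zero by linearity.\<close>

lemma amp_pad_zero:
  assumes \<Phi>: "\<Phi> \<in> channels d e"
  shows "amp 1 d e n \<Phi> (amp d z n 1 (pad_zero z n) X) = amp e z n 1 (pad_zero z n) (amp 1 d e z \<Phi> X)"
proof (rule eq_matI; simp)
  fix i j assume i: "i < e * n" "j < e * n"
  obtain x w where 1: "i = x * n + w" "x < e" "w < n" using i(1) by (rule digits_exist)
  obtain y v where 2: "j = y * n + v" "y < e" "v < n" using i(2) by (rule digits_exist)
  let ?c = "w < z \<and> v < z"
  have "mat d d (\<lambda>(k, m). amp d z n 1 (pad_zero z n) X $$ (k * n + w, m * n + v))
      = (if ?c then mat d d (\<lambda>(k, m). X $$ (k * z + w, m * z + v)) else 0\<^sub>m d d)"
    using 1 2 by (intro eq_matI) (auto simp: amp_index amp_idx_def pad_zero_def digit_less digit_simps)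
  then have "amp 1 d e n \<Phi> (amp d z n 1 (pad_zero z n) X) $$ (i, j)
      = (if ?c then \<Phi> (mat d d (\<lambda>(k, m). X $$ (k * z + w, m * z + v))) $$ (x, y) else 0)"
    using i 1 2 by (simp add: amp_index amp_idx_def digit_simps channel_zero[OF \<Phi>])
  also have "\<dots> = amp e z n 1 (pad_zero z n) (amp 1 d e z \<Phi> X) $$ (i, j)"
    using i 1 2 by (simp add: amp_index amp_idx_def pad_zero_def digit_less digit_simps)
  finally show "amp (Suc 0) d e n \<Phi> (amp d z n (Suc 0) (pad_zero z n) X) $$ (i, j)
      = amp e z n (Suc 0) (pad_zero z n) (amp (Suc 0) d e z \<Phi> X) $$ (i, j)" by simp
qed

section \<open>Measurement as a channel\<close>

definition povm_map :: "(nat \<Rightarrow> complex mat) \<Rightarrow> complex mat \<Rightarrow> complex mat" where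
  "povm_map M X = mat_diag 2 (\<lambda>x. tr (M x * X))"

lemma tr_mult:
  "A \<in> carrier_mat e e \<Longrightarrow> X \<in> carrier_mat e e \<Longrightarrow> tr (A * X) = (\<Sum>s<e. \<Sum>t<e. A $$ (s, t) * X $$ (t, s))"
  by (auto simp: tr_def scalar_prod_def atLeast0LessThan intro!: sum.cong)

lemma
  assumes "A \<in> carrier_mat e e" "X \<in> carrier_mat e e" "Y \<in> carrier_mat e e"
  shows tr_mult_add_right: "tr (A * (X + Y)) = tr (A * X) + tr (A * Y)"
    and tr_mult_add_left: "tr ((X + Y) * A) = tr (X * A) + tr (Y * A)"
    and tr_mult_smult: "tr (A * (z \<cdot>\<^sub>m X)) = z * tr (A * X)"
proof -
  note [simp] = tr_mult[OF assms(1)] tr_mult[OF _ assms(1)]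
  show "tr (A * (X + Y)) = tr (A * X) + tr (A * Y)" "tr ((X + Y) * A) = tr (X * A) + tr (Y * A)"
    using assms by (simp_all add: sum.distrib[symmetric] distrib_left distrib_right)
  show "tr (A * (z \<cdot>\<^sub>m X)) = z * tr (A * X)"
    using assms by (simp add: sum_distrib_left mult.left_commute)
qed
lemma povm_map_channel:
  assumes "psd e (M 0)" "psd e (M 1)" "M 0 + M 1 = 1\<^sub>m e" "0 < e"
  shows "povm_map M \<in> channels e 2"
proof (rule channelI)
  have M: "psd e (M x)" "M x \<in> carrier_mat e e" if "x < 2" for x
    using assms(1,2) that by (auto simp: less_2_cases_iff dest: psd_carrier)
  {
    fix X :: "complex mat" assume "X \<in> carrier_mat e e"
    then show "tr (povm_map M X) = tr X"
      using M[of 0] M[of 1] assms(3) tr_mult_add_left[of X e "M 0" "M 1"]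
      by (simp add: tr_def[of "mat _ _ _"] povm_map_def mat_diag_def numeral_2_eq_2)
  next
    fix X Y :: "complex mat" assume X: "X \<in> carrier_mat e e" and Y: "Y \<in> carrier_mat e e"
    show "povm_map M (X + Y) = povm_map M X + povm_map M Y"
      using tr_mult_add_right[OF M(2) X Y] by (intro eq_matI) (auto simp: povm_map_def mat_diag_def)
  next
    fix X :: "complex mat" and z assume X: "X \<in> carrier_mat e e"
    show "povm_map M (z \<cdot>\<^sub>m X) = z \<cdot>\<^sub>m povm_map M X"
      using tr_mult_smult[OF M(2) X X] by (intro eq_matI) (auto simp: povm_map_def mat_diag_def)
  next
    fix k X assume X: "psd (e * k) X"
    let ?Y = "amp 1 e 2 k (povm_map M) X"
    have Y: "?Y $$ (x * k + p, y * k + q)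
        = (if x = y then \<Sum>s<e. \<Sum>t<e. M x $$ (s, t) * X $$ (t * k + p, s * k + q) else 0)"
      if "x < 2" "y < 2" "p < k" "q < k" for x y p q
      using that M(2) digit_less[of x 2 p k] digit_less[of y 2 q k]
      by (simp add: amp_index povm_map_def mat_diag_def amp_idx_def digit_simps tr_mult[of _ e])
    show "psd (2 * k) ?Y"
      unfolding psd_iff_quadratic_form
    proof (intro conjI allI)
      fix f :: "nat \<Rightarrow> complex"
      \<comment> \<open>Contracting the reference of \<open>X\<close> with the part of
        \<open>f\<close> belonging to the outcome \<open>x\<close> leaves a positive matrix
        \<open>Z x\<close> on the measured system. As \<open>?Y\<close> is block diagonal in the
        outcome, its form at \<open>f\<close> is the sum over \<open>x\<close> of the traces of
        \<open>M x\<close> times \<open>Z x\<close>.\<close>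
      define Z where "Z x t s = (\<Sum>p<k. \<Sum>q<k. X $$ (t * k + p, s * k + q) * f (x * k + q) * cnj (f (x * k + p)))" for x t s
      have Z: "psd_on {..<e} (Z x)" for x
        unfolding psd_on_def
      proof
        fix g :: "nat \<Rightarrow> complex"
        let ?h = "\<lambda>i. g (i div k) * f (x * k + i mod k)"
        have "(\<Sum>t<e. \<Sum>s<e. Z x t s * g s * cnj (g t))
          = (\<Sum>t<e. \<Sum>p<k. \<Sum>s<e. \<Sum>q<k. X $$ (t * k + p, s * k + q) * f (x * k + q) * cnj (f (x * k + p)) * g s * cnj (g t))"
          unfolding Z_def sum_distrib_right by (rule sum.cong[OF refl], rule sum.swap)
        also have "\<dots> = (\<Sum>i<e * k. \<Sum>j<e * k. X $$ (i, j) * ?h j * cnj (?h i))"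
          unfolding sum_digits by (intro sum.cong refl) (simp add: digit_div digit_mod)
        also have "\<dots> \<ge> 0" using X unfolding psd_iff_quadratic_form by (elim conjE allE[where x="?h"])
        finally show "0 \<le> (\<Sum>t<e. \<Sum>s<e. Z x t s * g s * cnj (g t))" .
      qed
      have "(\<Sum>i<2 * k. \<Sum>j<2 * k. ?Y $$ (i, j) * f j * cnj (f i))
        = (\<Sum>x<2. \<Sum>p<k. \<Sum>y<2. \<Sum>q<k. ?Y $$ (x * k + p, y * k + q) * f (y * k + q) * cnj (f (x * k + p)))"
        unfolding sum_digits ..
      also have "\<dots> = (\<Sum>x<2. \<Sum>p<k. \<Sum>y<2. \<Sum>q<k.
          (if x = y then \<Sum>s<e. \<Sum>t<e. M x $$ (s, t) * X $$ (t * k + p, s * k + q) else 0)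
            * f (y * k + q) * cnj (f (x * k + p)))"
        by (intro sum.cong refl) (simp only: Y lessThan_iff)
      also have "\<dots> = (\<Sum>x<2. \<Sum>p<k. \<Sum>q<k. \<Sum>s<e. \<Sum>t<e.
          M x $$ (s, t) * X $$ (t * k + p, s * k + q) * f (x * k + q) * cnj (f (x * k + p)))"
      proof (rule sum.cong[OF refl], rule sum.cong[OF refl])
        fix x p :: nat assume x: "x \<in> {..<2}"
        let ?g = "\<lambda>y. \<Sum>q<k. \<Sum>s<e. \<Sum>t<e.
          M x $$ (s, t) * X $$ (t * k + p, s * k + q) * f (y * k + q) * cnj (f (x * k + p))"
        have "(\<Sum>y<2. \<Sum>q<k.
          (if x = y then \<Sum>s<e. \<Sum>t<e. M x $$ (s, t) * X $$ (t * k + p, s * k + q) else 0)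
            * f (y * k + q) * cnj (f (x * k + p))) = (\<Sum>y<2. if x = y then ?g y else 0)"
          by (intro sum.cong refl) (simp add: sum_distrib_right)
        also have "\<dots> = ?g x" using x by simp
        finally show "(\<Sum>y<2. \<Sum>q<k.
          (if x = y then \<Sum>s<e. \<Sum>t<e. M x $$ (s, t) * X $$ (t * k + p, s * k + q) else 0)
            * f (y * k + q) * cnj (f (x * k + p))) = ?g x" .
      qed
      also have "\<dots> = (\<Sum>x<2. \<Sum>s<e. \<Sum>t<e. \<Sum>p<k. \<Sum>q<k.
          M x $$ (s, t) * X $$ (t * k + p, s * k + q) * f (x * k + q) * cnj (f (x * k + p)))"
        by (simp only: sum.swap[of _ "{..<k}" "{..<e}"])
      also have "\<dots> = (\<Sum>x<2. \<Sum>s<e. \<Sum>t<e. M x $$ (s, t) * Z x t s)"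
        by (simp add: Z_def sum_distrib_left mult_ac)
      also have "\<dots> \<ge> 0"
        using M(1) psd_imp_psd_on Z by (intro sum_nonneg[of "{..<2}"] trace_prod_psd_nonneg) auto
      finally show "0 \<le> (\<Sum>i<2 * k. \<Sum>j<2 * k. ?Y $$ (i, j) * f j * cnj (f i))" .
    qed (metis amp_carrier mult_1)
  }
qed (use assms in \<open>auto simp: povm_map_def\<close>)

section \<open>Strategies with a separate superchannel for each copy\<close>

text \<open>Copies may carry different superchannels, so the power of one memory dimension becomes a
  product over the open copies.\<close>

definition mdim :: "(nat \<Rightarrow> superchannel) \<Rightarrow> nat list \<Rightarrow> nat" where
  "mdim \<Theta> js = (\<Prod>j\<leftarrow>js. mem_dim (\<Theta> j))"

lemma mdim_simps [simp]:
  "mdim \<Theta> [] = 1" "mdim \<Theta> (j # js) = mem_dim (\<Theta> j) * mdim \<Theta> js"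
  "mdim \<Theta> (us @ vs) = mdim \<Theta> us * mdim \<Theta> vs"
  by (simp_all add: mdim_def)

lemma mdim_cong: "(\<And>j. j \<in> set js \<Longrightarrow> \<Theta> j = \<Theta>' j) \<Longrightarrow> mdim \<Theta> js = mdim \<Theta>' js"
  by (induction js) auto

definition mems_after :: "nat list \<Rightarrow> component \<Rightarrow> nat list" where
  "mems_after ms t = (case t of Pre j \<Rightarrow> ms @ [j] | Post j \<Rightarrow> filter (\<lambda>i. i \<noteq> j) ms)"

definition usable :: "nat list \<Rightarrow> component \<Rightarrow> bool" where
  "usable ms t = (case t of Pre j \<Rightarrow> j \<notin> set ms | Post j \<Rightarrow> j \<in> set ms)"

lemma filter_neq: "i \<notin> set js \<Longrightarrow> filter (\<lambda>k. k \<noteq> i) js = js"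
  by (induction js) auto

context
  fixes a b c d :: nat
begin

text \<open>The argument is the list of open memories rather than the earlier components as in
  \<open>apply_component\<close>, because the memory of one copy is to be deleted from it.\<close>

definition comp_map :: "(nat \<Rightarrow> superchannel) \<Rightarrow> nat \<Rightarrow> nat list \<Rightarrow> component \<Rightarrow> complex mat \<Rightarrow> complex mat"
  where
  "comp_map \<Theta> r ms t = (case t of
     Pre j \<Rightarrow> amp (mdim \<Theta> ms) c (mem_dim (\<Theta> j) * a) r (pre (\<Theta> j))
   | Post j \<Rightarrow>
       (let u = mdim \<Theta> (takeWhile (\<lambda>i. i \<noteq> j) ms); v = mdim \<Theta> (tl (dropWhile (\<lambda>i. i \<noteq> j) ms))
        in amp (u * v) (mem_dim (\<Theta> j) * b) d r (post (\<Theta> j)) \<circ> swap_mid u (mem_dim (\<Theta> j)) v (b * r)))"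

lemma comp_map_Pre: "comp_map \<Theta> r ms (Pre j) = amp (mdim \<Theta> ms) c (mem_dim (\<Theta> j) * a) r (pre (\<Theta> j))"
  by (simp add: comp_map_def)

lemma comp_map_Post:
  assumes "j \<notin> set us"
  shows "comp_map \<Theta> r (us @ j # vs) (Post j) =
    amp (mdim \<Theta> us * mdim \<Theta> vs) (mem_dim (\<Theta> j) * b) d r (post (\<Theta> j))
    \<circ> swap_mid (mdim \<Theta> us) (mem_dim (\<Theta> j)) (mdim \<Theta> vs) (b * r)"
proof -
  have "takeWhile (\<lambda>i. i \<noteq> j) (us @ j # vs) = us" "dropWhile (\<lambda>i. i \<noteq> j) (us @ j # vs) = j # vs"
    using assms by (induction us) auto
  then show ?thesis by (simp add: comp_map_def Let_def)
qed

abbreviation superchannels :: "(nat \<Rightarrow> superchannel) \<Rightarrow> bool" where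
  "superchannels \<Theta> \<equiv> \<forall>j. is_superchannel a b c d (\<Theta> j)"

lemma superchannel_pos:
  assumes "is_superchannel a b c d \<theta>"
  shows "0 < mem_dim \<theta>" "0 < a" "0 < b" "0 < c" "0 < d"
  using assms by (auto simp: is_superchannel_def dest: channel_pos)

lemma mdim_pos:
  assumes "superchannels \<Theta>"
  shows "0 < mdim \<Theta> js"
  using assms by (induction js) (auto dest: superchannel_pos)

lemma comp_map_channel:
  assumes "superchannels \<Theta>" "0 < r" "distinct ms" "usable ms t"
  shows "comp_map \<Theta> r ms t \<in> channels (mdim \<Theta> ms * (in_dim b c t * r))
           (mdim \<Theta> (mems_after ms t) * (out_dim a d t * r))"
proof (cases t)
  case (Pre j)
  have "pre (\<Theta> j) \<in> channels c (mem_dim (\<Theta> j) * a)" using assms(1) by (auto simp: is_superchannel_def)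
  then show ?thesis unfolding Pre comp_map_Pre mems_after_def
    by (rule amp_channel') (use mdim_pos[OF assms(1)] assms(2) in \<open>auto simp: mult_ac\<close>)
next
  case (Post j)
  then obtain us vs where ms: "ms = us @ j # vs" using assms(4) by (auto simp: usable_def dest: split_list)
  then have j: "j \<notin> set us" "j \<notin> set vs" using assms(3) by auto
  have "post (\<Theta> j) \<in> channels (mem_dim (\<Theta> j) * b) d" using assms(1) by (auto simp: is_superchannel_def)
  then have "amp (mdim \<Theta> us * mdim \<Theta> vs) (mem_dim (\<Theta> j) * b) d r (post (\<Theta> j))
     \<in> channels (mdim \<Theta> us * mdim \<Theta> vs * mem_dim (\<Theta> j) * (b * r)) (mdim \<Theta> us * mdim \<Theta> vs * (d * r))"
    by (rule amp_channel') (use mdim_pos[OF assms(1)] assms(2) in \<open>auto simp: mult_ac\<close>)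
  moreover have "swap_mid (mdim \<Theta> us) (mem_dim (\<Theta> j)) (mdim \<Theta> vs) (b * r)
     \<in> channels (mdim \<Theta> ms * (b * r)) (mdim \<Theta> us * mdim \<Theta> vs * mem_dim (\<Theta> j) * (b * r))"
    by (rule swap_mid_channel')
      (use mdim_pos[OF assms(1)] superchannel_pos[OF assms(1)[rule_format]] assms(2) in \<open>auto simp: ms mult_ac\<close>)
  moreover have "mems_after ms (Post j) = us @ vs"
    using j by (auto simp: mems_after_def ms filter_neq)
  ultimately show ?thesis unfolding Post
    using comp_channel by (fastforce simp: ms comp_map_Post[OF j(1)])
qed

lemma comp_map_cong:
  assumes "\<And>i. i \<in> set ms \<Longrightarrow> \<Theta> i = \<Theta>' i" "\<And>j. t = Pre j \<or> t = Post j \<Longrightarrow> \<Theta> j = \<Theta>' j"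
  shows "comp_map \<Theta> r ms t = comp_map \<Theta>' r ms t"
proof -
  have "mdim \<Theta> (takeWhile P ms) = mdim \<Theta>' (takeWhile P ms)"
    "mdim \<Theta> (tl (dropWhile P ms)) = mdim \<Theta>' (tl (dropWhile P ms))" for P
    using assms(1) by (auto intro!: mdim_cong dest: set_takeWhileD set_dropWhileD list.set_sel(2)[rotated])
      (metis dropWhile.simps(1) list.sel(2) list.set_sel(2) set_dropWhileD)
  moreover have "mdim \<Theta> ms = mdim \<Theta>' ms" using assms(1) by (rule mdim_cong)
  ultimately show ?thesis using assms(2) by (auto simp: comp_map_def split: component.split)
qed

text \<open>A component of another copy acts as the identity on the memory of copy \<open>j\<close>, which is made
  explicit by moving this memory to the front.\<close>

lemma comp_map_remove:
  assumes "distinct (us @ j # vs)" "usable (us @ j # vs) t" "t \<noteq> Pre j" "t \<noteq> Post j"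
  obtains us' vs' where "mems_after (us @ j # vs) t = us' @ j # vs'" "mems_after (us @ vs) t = us' @ vs'"
    "\<And>X. swap_mid 1 (mdim \<Theta> us') (mem_dim (\<Theta> j)) (mdim \<Theta> vs' * (out_dim a d t * r))
          (comp_map \<Theta> r (us @ j # vs) t X)
        = amp (mem_dim (\<Theta> j)) (mdim \<Theta> (us @ vs) * (in_dim b c t * r)) (mdim \<Theta> (us' @ vs') * (out_dim a d t * r)) 1
            (comp_map \<Theta> r (us @ vs) t)
            (swap_mid 1 (mdim \<Theta> us) (mem_dim (\<Theta> j)) (mdim \<Theta> vs * (in_dim b c t * r)) X)"
proof (cases t)
  case (Pre i)
  let ?u = "mdim \<Theta> us" and ?v = "mdim \<Theta> vs" and ?s = "mem_dim (\<Theta> j)" and ?e = "mem_dim (\<Theta> i) * a"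
  show ?thesis
  proof (rule that)
    show "mems_after (us @ j # vs) t = us @ j # (vs @ [i])" "mems_after (us @ vs) t = us @ (vs @ [i])"
      by (simp_all add: Pre mems_after_def)
    show "swap_mid 1 (mdim \<Theta> us) ?s (mdim \<Theta> (vs @ [i]) * (out_dim a d t * r)) (comp_map \<Theta> r (us @ j # vs) t X)
        = amp ?s (mdim \<Theta> (us @ vs) * (in_dim b c t * r)) (mdim \<Theta> (us @ vs @ [i]) * (out_dim a d t * r)) 1
            (comp_map \<Theta> r (us @ vs) t) (swap_mid 1 (mdim \<Theta> us) ?s (mdim \<Theta> vs * (in_dim b c t * r)) X)" for X
      using swap_amp_right[of 1 ?u ?s ?v ?e r c "pre (\<Theta> i)" X]
        amp_amp[of ?s "?u * ?v" c r ?e 1 "pre (\<Theta> i)" "swap_mid 1 ?u ?s (?v * c * r) X"]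
      by (simp add: Pre comp_map_Pre mult_ac)
  qed
next
  case (Post i)
  let ?u = "mdim \<Theta> us" and ?v = "mdim \<Theta> vs" and ?s = "mem_dim (\<Theta> j)"
  let ?p = "mem_dim (\<Theta> i)" and ?\<Phi> = "post (\<Theta> i)"
  have "i \<noteq> j" using Post assms(4) by auto
  have "i \<in> set us \<union> set vs" using Post assms(2,4) by (auto simp: usable_def)
  then consider (left) "i \<in> set us" | (right) "i \<in> set vs" by auto
  then show ?thesis
  proof cases
    case right
    then obtain v1 v2 where vs: "vs = v1 @ i # v2" by (auto dest: split_list)
    have i: "i \<notin> set us" "i \<notin> set v1" "i \<notin> set v2" using assms(1) by (auto simp: vs)
    let ?v1 = "mdim \<Theta> v1" and ?v2 = "mdim \<Theta> v2"
    show ?thesis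
    proof (rule that)
      show "mems_after (us @ j # vs) t = us @ j # (v1 @ v2)" "mems_after (us @ vs) t = us @ (v1 @ v2)"
        using i \<open>i \<noteq> j\<close> by (auto simp: Post mems_after_def vs filter_neq)
      show "swap_mid 1 (mdim \<Theta> us) ?s (mdim \<Theta> (v1 @ v2) * (out_dim a d t * r)) (comp_map \<Theta> r (us @ j # vs) t X)
          = amp ?s (mdim \<Theta> (us @ vs) * (in_dim b c t * r)) (mdim \<Theta> (us @ v1 @ v2) * (out_dim a d t * r)) 1
            (comp_map \<Theta> r (us @ vs) t) (swap_mid 1 (mdim \<Theta> us) ?s (mdim \<Theta> vs * (in_dim b c t * r)) X)" for X
        using swap_amp_right[of 1 ?u ?s "?v1 * ?v2" d r "?p * b" ?\<Phi> "swap_mid (?u * ?s * ?v1) ?p ?v2 (b * r) X"]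
          swap_swap_right[of ?u ?s ?v1 ?v2 ?p "b * r" X]
          amp_swap_mid[of ?s "?u * ?v1" ?p ?v2 "b * r" 1 "swap_mid 1 ?u ?s (?v1 * ?p * ?v2 * (b * r)) X"]
          amp_amp[of ?s "?u * ?v1 * ?v2" "?p * b" r d 1 ?\<Phi>
            "swap_mid (?s * ?u * ?v1) ?p ?v2 (b * r) (swap_mid 1 ?u ?s (?v1 * ?p * ?v2 * (b * r)) X)"]
          amp_comp[of "?u * ?v * (b * r)" "swap_mid (?u * ?v1) ?p ?v2 (b * r)" "?u * ?v * (b * r)" ?s "?u * ?v1 * ?v2 * (d * r)" 1
            "amp (?u * ?v1 * ?v2) (?p * b) d r ?\<Phi>" "swap_mid 1 ?u ?s (?v1 * ?p * ?v2 * (b * r)) X"]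
          comp_map_Post[of i "us @ j # v1" \<Theta> r v2] comp_map_Post[of i "us @ v1" \<Theta> r v2]
          swap_mid_carrier[of "?u * ?v1" ?p ?v2 "b * r"] i \<open>i \<noteq> j\<close>
        by (simp add: Post vs mult_ac comp_def)
    qed
  next
    \<comment> \<open>Copy \<open>i\<close> was opened before copy \<open>j\<close>, so its memory
      has to cross that of copy \<open>j\<close>; it no longer does once the latter is in
      front.\<close>
    case left
    then obtain u1 u2 where us: "us = u1 @ i # u2" by (auto dest: split_list)
    have i: "i \<notin> set vs" "i \<notin> set u1" "i \<notin> set u2" using assms(1) by (auto simp: us)
    let ?u1 = "mdim \<Theta> u1" and ?u2 = "mdim \<Theta> u2"
    show ?thesis
    proof (rule that)
      show "mems_after (us @ j # vs) t = (u1 @ u2) @ j # vs" "mems_after (us @ vs) t = (u1 @ u2) @ vs"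
        using i \<open>i \<noteq> j\<close> by (auto simp: Post mems_after_def us filter_neq)
      show "swap_mid 1 (mdim \<Theta> (u1 @ u2)) ?s (mdim \<Theta> vs * (out_dim a d t * r)) (comp_map \<Theta> r (us @ j # vs) t X)
          = amp ?s (mdim \<Theta> (us @ vs) * (in_dim b c t * r)) (mdim \<Theta> ((u1 @ u2) @ vs) * (out_dim a d t * r)) 1
            (comp_map \<Theta> r (us @ vs) t) (swap_mid 1 (mdim \<Theta> us) ?s (mdim \<Theta> vs * (in_dim b c t * r)) X)" for X
        using swap_amp_right[of 1 "?u1 * ?u2" ?s ?v d r "?p * b" ?\<Phi> "swap_mid ?u1 ?p (?u2 * ?s * ?v) (b * r) X"]
          swap_swap_left[of ?u1 ?u2 ?s ?v ?p "b * r" X]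
          amp_swap_mid[of ?s ?u1 ?p "?u2 * ?v" "b * r" 1 "swap_mid 1 (?u1 * ?p * ?u2) ?s (?v * (b * r)) X"]
          amp_amp[of ?s "?u1 * ?u2 * ?v" "?p * b" r d 1 ?\<Phi>
            "swap_mid (?s * ?u1) ?p (?u2 * ?v) (b * r) (swap_mid 1 (?u1 * ?p * ?u2) ?s (?v * (b * r)) X)"]
          amp_comp[of "?u * ?v * (b * r)" "swap_mid ?u1 ?p (?u2 * ?v) (b * r)" "?u * ?v * (b * r)" ?s "?u1 * ?u2 * ?v * (d * r)" 1
            "amp (?u1 * ?u2 * ?v) (?p * b) d r ?\<Phi>" "swap_mid 1 (?u1 * ?p * ?u2) ?s (?v * (b * r)) X"]
          comp_map_Post[of i u1 \<Theta> r "u2 @ j # vs"] comp_map_Post[of i u1 \<Theta> r "u2 @ vs"]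
          swap_mid_carrier[of ?u1 ?p "?u2 * ?v" "b * r"] i \<open>i \<noteq> j\<close>
        by (simp add: Post us mult_ac comp_def)
    qed
  qed
qed

end

section \<open>Padding the reference system\<close>

lemma amp_id:
  assumes "\<And>Y. Y \<in> carrier_mat d d \<Longrightarrow> \<Phi> Y = Y" "X \<in> carrier_mat (l * d * r) (l * d * r)"
  shows "amp l d d r \<Phi> X = X"
proof (rule eq_matI)
  fix i j assume "i < dim_row X" "j < dim_col X"
  then have i: "i < l * d * r" "j < l * d * r" using assms(2) by auto
  then have "0 < d" "0 < r" by (auto intro: ccontr)
  moreover have "amp_idx d d r i (i div r mod d) = i" for i
    unfolding amp_idx_def by (metis div_mult_mod_eq div_prod)
  ultimately show "amp l d d r \<Phi> X $$ (i, j) = X $$ (i, j)"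
    using i by (simp add: amp_index assms(1))
qed (use assms(2) in auto)

text \<open>\<open>N\<close> is \<open>L\<close> with its references of dimensions \<open>z\<close>
  and \<open>z'\<close> both replaced by one of dimension \<open>r\<close>: it traces down to
  \<open>z\<close>, applies \<open>L\<close> and pads again. Padding the input commutes with
  \<open>F\<close> and is then cancelled by the partial trace, so only the final padding
  remains.\<close>

lemma padded_comb:
  assumes L: "L \<in> channels (a * z) (b * z')" and r: "r = q * z" "0 < q" and F: "F \<in> channels c (s * a)"
  defines "N \<equiv> amp b z' r 1 (pad_zero z' r) \<circ> L \<circ> amp a r z 1 (ptrace q z)"
  shows "amp s (a * r) (b * r) 1 N (amp 1 c (s * a) r F (amp c z r 1 (pad_zero z r) Y))
    = amp (s * b) z' r 1 (pad_zero z' r) (amp s (a * z) (b * z') 1 L (amp 1 c (s * a) z F Y))"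
proof -
  let ?V = "amp 1 c (s * a) z F Y" and ?P = "amp a z r 1 (pad_zero z r)"
  have pad: "Y \<in> carrier_mat k k \<Longrightarrow> pad_zero k r Y \<in> carrier_mat r r" for k Y by (simp add: pad_zero_def)
  have unpad: "amp a r z 1 (ptrace q z) (?P Z) = Z" if "Z \<in> carrier_mat (a * z) (a * z)" for Z
    using amp_comp[of z "pad_zero z r" r a z 1 "ptrace q z" Z, OF pad] that
    by (simp add: amp_id ptrace_pad_zero r)
  have "amp s (a * r) (b * r) 1 N (amp 1 c (s * a) r F (amp c z r 1 (pad_zero z r) Y))
      = amp s (a * r) (b * r) 1 N (amp s (a * z) (a * r) 1 ?P ?V)"
    using amp_pad_zero[OF F, of r z Y] amp_amp[of s a z 1 r 1 "pad_zero z r" ?V] by simp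
  also have "\<dots> = amp s (a * z) (b * r) 1 (\<lambda>Z. N (?P Z)) ?V"
    using amp_carrier[of a z r 1] by (intro amp_comp) simp
  also have "\<dots> = amp s (a * z) (b * r) 1 (\<lambda>Z. amp b z' r 1 (pad_zero z' r) (L Z)) ?V"
    by (rule arg_cong[where f="\<lambda>f. f ?V"], rule amp_cong) (simp add: N_def unpad del: One_nat_def)
  also have "\<dots> = amp s (b * z') (b * r) 1 (amp b z' r 1 (pad_zero z' r)) (amp s (a * z) (b * z') 1 L ?V)"
    by (rule amp_comp[symmetric]) (rule channel_carrier[OF L])
  also have "\<dots> = amp (s * b) z' r 1 (pad_zero z' r) (amp s (a * z) (b * z') 1 L ?V)"
    using amp_amp[of s b z' 1 r 1 "pad_zero z' r"] by simp
  finally show ?thesis .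
qed

section \<open>Amortized divergences\<close>

lemma states_pos: "\<rho> \<in> states d \<Longrightarrow> 0 < d"
  by (rule ccontr) (auto simp: states_def psd_def tr_def)

lemma div_diff_mono: "x \<le> x' \<Longrightarrow> div_diff x y \<le> div_diff x' y"
  by (simp add: div_diff_def ereal_minus_mono)

lemma amp_states:
  assumes "N \<in> channels i e" "\<rho> \<in> states (i * k)"
  shows "amp 1 i e k N \<rho> \<in> states (e * k)"
  using channel_states[OF amp_channel'[OF assms(1), of "i * k" 1 k "e * k"] assms(2)]
    states_pos[OF assms(2)] by simp

text \<open>Each term of the supremum decreases, by data processing for \<open>\<Phi>\<close>
  tensored with the identity on the reference. The factorizations are required only on matrices of
  the right size, where channels are meaningful.\<close>

lemma amortized_div_data_processing:
  assumes D: "generalized_divergence D" and \<Phi>: "\<Phi> \<in> channels e f"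
    and N: "N \<in> channels i e" "\<And>X. X \<in> carrier_mat i i \<Longrightarrow> N' X = \<Phi> (N X)"
    and M: "M \<in> channels i e" "\<And>X. X \<in> carrier_mat i i \<Longrightarrow> M' X = \<Phi> (M X)"
  shows "amortized_div D i f N' M' \<le> amortized_div D i e N M"
  unfolding amortized_div_def
proof (rule Sup_mono, clarify)
  fix k \<rho> \<tau> assume \<rho>: "\<rho> \<in> states (i * k)" "\<tau> \<in> states (i * k)"
  have eq: "amp 1 i f k N' X = amp 1 e f k \<Phi> (amp 1 i e k N X)"
    "amp 1 i f k M' X = amp 1 e f k \<Phi> (amp 1 i e k M X)" for X
    using amp_cong[of i N' "\<lambda>X. \<Phi> (N X)"] amp_cong[of i M' "\<lambda>X. \<Phi> (M X)"]
    by (simp_all add: N(2) M(2) amp_comp channel_carrier[OF N(1)] channel_carrier[OF M(1)])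
  have "amp 1 e f k \<Phi> \<in> channels (e * k) (f * k)"
    using amp_channel[OF \<Phi>, of 1 k] states_pos[OF \<rho>(1)] by simp
  then have "D (amp 1 i f k N' \<rho>) (amp 1 i f k M' \<tau>) \<le> D (amp 1 i e k N \<rho>) (amp 1 i e k M \<tau>)"
    unfolding eq using D amp_states[OF N(1) \<rho>(1)] amp_states[OF M(1) \<rho>(2)]
    by (auto simp: generalized_divergence_def)
  then have "div_diff (D (amp 1 i f k N' \<rho>) (amp 1 i f k M' \<tau>)) (D \<rho> \<tau>)
      \<le> div_diff (D (amp 1 i e k N \<rho>) (amp 1 i e k M \<tau>)) (D \<rho> \<tau>)"
    by (rule div_diff_mono)
  then show "\<exists>x\<in>{div_diff (D (amp 1 i e k N \<rho>) (amp 1 i e k M \<tau>)) (D \<rho> \<tau>) |k \<rho> \<tau>.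
      \<rho> \<in> states (i * k) \<and> \<tau> \<in> states (i * k)}.
      div_diff (D (amp 1 i f k N' \<rho>) (amp 1 i f k M' \<tau>)) (D \<rho> \<tau>) \<le> x"
    using \<rho> by blast
qed

text \<open>For finite \<open>D \<rho> \<tau>\<close> this is data processing under
  \<open>N\<close>; for infinite \<open>D \<rho> \<tau>\<close> the convention of
  \<open>div_diff\<close> makes the term \<open>-\<infinity>\<close>.\<close>

lemma amortized_div_same:
  assumes D: "generalized_divergence D" and N: "N \<in> channels i e"
  shows "amortized_div D i e N N \<le> 0"
  unfolding amortized_div_def
proof (rule Sup_least, clarify)
  fix k \<rho> \<tau> assume \<rho>: "\<rho> \<in> states (i * k)" "\<tau> \<in> states (i * k)"
  have "amp 1 i e k N \<in> channels (i * k) (e * k)"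
    using amp_channel[OF N, of 1 k] states_pos[OF \<rho>(1)] by simp
  then have "D (amp 1 i e k N \<rho>) (amp 1 i e k N \<tau>) \<le> D \<rho> \<tau>" "D \<rho> \<tau> \<noteq> -\<infinity>"
    using D \<rho> by (auto simp: generalized_divergence_def)
  then show "div_diff (D (amp 1 i e k N \<rho>) (amp 1 i e k N \<tau>)) (D \<rho> \<tau>) \<le> 0"
    by (cases "D \<rho> \<tau>"; cases "D (amp 1 i e k N \<rho>) (amp 1 i e k N \<tau>)") (auto simp: div_diff_def)
qed

text \<open>In the supremum take a trivial reference and equal inputs: by weak faithfulness the
  subtracted term \<open>D \<rho> \<rho>\<close> is at most 0.\<close>

lemma div_le_amortized_div:
  assumes D: "generalized_divergence D" "weakly_faithful D"
    and N: "N \<in> channels i e" and M: "M \<in> channels i e" and \<rho>: "\<rho> \<in> states i"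
  shows "D (N \<rho>) (M \<rho>) \<le> amortized_div D i e N M"
proof -
  have "\<rho> \<in> carrier_mat i i" using \<rho> by (auto simp: states_def dest: psd_carrier)
  then have eq: "amp 1 i e 1 N \<rho> = N \<rho>" "amp 1 i e 1 M \<rho> = M \<rho>"
    by (simp_all add: amp_trivial channel_carrier[OF N] channel_carrier[OF M] del: One_nat_def)
  have "D \<rho> \<rho> \<le> 0" "D \<rho> \<rho> \<noteq> -\<infinity>"
    using D \<rho> by (auto simp: weakly_faithful_def generalized_divergence_def)
  then have "D (N \<rho>) (M \<rho>) \<le> div_diff (D (N \<rho>) (M \<rho>)) (D \<rho> \<rho>)"
    by (cases "D \<rho> \<rho>"; cases "D (N \<rho>) (M \<rho>)") (auto simp: div_diff_def)
  also have "\<dots> \<le> amortized_div D i e N M"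
    unfolding amortized_div_def
  proof (rule Sup_upper, rule CollectI, intro exI conjI)
    show "div_diff (D (N \<rho>) (M \<rho>)) (D \<rho> \<rho>)
        = div_diff (D (amp 1 i e 1 N \<rho>) (amp 1 i e 1 M \<rho>)) (D \<rho> \<rho>)"
      unfolding eq ..
  qed (use \<rho> in simp_all)
  finally show ?thesis .
qed

text \<open>The inequality behind the induction: \<open>A'\<close> exceeds each \<open>B s F\<close>
  by the corresponding difference, the infimum of the differences is at most \<open>X\<close>, and
  every \<open>B s F\<close> is at most \<open>m\<close> times \<open>X\<close>. The work lies in
  the infinite values.\<close>

lemma amortization_step:
  fixes A A' X :: ereal and B :: "nat \<Rightarrow> 'f \<Rightarrow> ereal"
  assumes "Inf {div_diff A' (B s F) | s F. P s F} \<le> X" "A \<le> A'"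
    and B: "\<And>s F. P s F \<Longrightarrow> B s F \<le> ereal (real m) * X"
  shows "A \<le> ereal (real (Suc m)) * X"
proof (cases "X = \<infinity>")
  case False
  define Y where "Y = ereal (real m) * X"
  \<comment> \<open>This keeps every \<open>B s F\<close> below \<open>\<infinity>\<close>, so that
    \<open>div_diff\<close> is an ordinary difference.\<close>
  have Y: "Y \<noteq> \<infinity>" using False by (cases X) (auto simp: Y_def)
  have "A' - Y \<le> Inf {div_diff A' (B s F) | s F. P s F}"
  proof (rule Inf_greatest, clarify)
    fix s F assume "P s F"
    then have "B s F \<le> Y" using B Y_def by simp
    then show "A' - Y \<le> div_diff A' (B s F)"
      using Y by (auto simp: div_diff_def intro: ereal_minus_mono)
  qed
  then have "A' - Y \<le> X" using assms(1) by simp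
  \<comment> \<open>If \<open>X = -\<infinity>\<close>, then \<open>m = 0\<close> gives
    \<open>Y = 0\<close> and hence \<open>A' = -\<infinity>\<close>, whereas for positive
    \<open>m\<close> the difference \<open>A' - Y\<close> would be \<open>\<infinity>\<close>, a
    contradiction.\<close>
  then have "A' \<le> ereal (real (Suc m)) * X"
    using False unfolding Y_def
    by (cases X; cases A'; cases m) (auto simp: algebra_simps)
  then show ?thesis using assms(2) by simp
qed simp

section \<open>Adaptive strategies\<close>

lemma open_mems_filter: "open_mems ts = filter (\<lambda>j. Post j \<notin> set ts) [j. Pre j \<leftarrow> ts]"
proof -
  have *: "concat (map (\<lambda>t. case t of Pre j \<Rightarrow> if P j then [j] else [] | Post j \<Rightarrow> []) us)
      = filter P [j. Pre j \<leftarrow> us]" for P us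
  proof (induction us)
    case (Cons t us)
    then show ?case by (cases t) simp_all
  qed simp
  show ?thesis unfolding open_mems_def by (rule *)
qed

lemma set_pres: "set [j. Pre j \<leftarrow> ts] = {j. Pre j \<in> set ts}"
proof (induction ts)
  case (Cons t ts)
  then show ?case by (cases t) auto
qed simp

lemma set_open_mems: "set (open_mems ts) = {j. Pre j \<in> set ts \<and> Post j \<notin> set ts}"
  unfolding open_mems_filter set_filter set_pres by blast

lemma distinct_open_mems:
  assumes "distinct ts"
  shows "distinct (open_mems ts)"
proof -
  have "distinct [j. Pre j \<leftarrow> ts]" using assms
  proof (induction ts)
    case (Cons t ts)
    then show ?case using set_pres[of ts] by (cases t) auto
  qed simp
  then show ?thesis unfolding open_mems_filter by (rule distinct_filter)
qed

text \<open>A \<open>Pre j\<close> that comes after \<open>Post j\<close> would not be counted by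
  \<open>open_mems\<close> but would be appended by \<open>mems_after\<close>; the assumption
  excludes this.\<close>

lemma open_mems_snoc:
  assumes "\<And>j. t = Pre j \<Longrightarrow> Post j \<notin> set ts"
  shows "open_mems (ts @ [t]) = mems_after (open_mems ts) t"
proof (cases t)
  case (Pre i)
  then show ?thesis using assms[OF Pre] by (simp add: open_mems_filter mems_after_def)
next
  case (Post i)
  then show ?thesis by (simp add: open_mems_filter mems_after_def) (rule filter_cong; auto)
qed

text \<open>These are the data of a strategy without initial state and measurement. Positivity of
  \<open>r 0\<close> is assumed because the first reference is not part of the output of an
  interjected channel; the later dimensions are positive by \<open>inter\<close>.\<close>

locale adaptive =
  fixes a b c d n :: nat and T :: "component list" and r :: "nat \<Rightarrow> nat"
    and inter :: "nat \<Rightarrow> complex mat \<Rightarrow> complex mat"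
  assumes order: "valid_order n T"
    and inter: "\<And>k. Suc k < 2 * n \<Longrightarrow>
      inter k \<in> channels (out_dim a d (T ! k) * r k) (in_dim b c (T ! Suc k) * r (Suc k))"
    and r0: "0 < r 0"
begin

abbreviation "mems k \<equiv> open_mems (take k T)"
abbreviation "inp k \<equiv> in_dim b c (T ! k) * r k"
abbreviation "out k \<equiv> out_dim a d (T ! k) * r k"
abbreviation "comp_at \<Theta> k \<equiv> comp_map a b c d \<Theta> (r k) (mems k) (T ! k)"
abbreviation "inter_at \<Theta> k \<equiv> amp (mdim \<Theta> (mems (Suc k))) (out k) (inp (Suc k)) 1 (inter k)"
abbreviation "superchan \<theta> \<equiv> is_superchannel a b c d \<theta>"

text \<open>The strategy is cut on both sides of every component: \<open>bef\<close> stops where the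
  postprocessing of a copy can still be left out, while \<open>aft\<close> is what the induction
  compares.\<close>

primrec bef :: "(nat \<Rightarrow> superchannel) \<Rightarrow> nat \<Rightarrow> complex mat \<Rightarrow> complex mat" where
  "bef \<Theta> 0 = id"
| "bef \<Theta> (Suc k) = inter_at \<Theta> k \<circ> comp_at \<Theta> k \<circ> bef \<Theta> k"

definition aft :: "(nat \<Rightarrow> superchannel) \<Rightarrow> nat \<Rightarrow> complex mat \<Rightarrow> complex mat" where
  "aft \<Theta> k = comp_at \<Theta> k \<circ> bef \<Theta> k"

lemma bef_Suc: "bef \<Theta> (Suc k) = inter_at \<Theta> k \<circ> aft \<Theta> k"
  by (simp add: aft_def comp_assoc)

section \<open>Positions of the components and open memories\<close>

lemma distinct_T: "distinct T"
  and set_T: "set T = Pre ` {..<n} \<union> Post ` {..<n}"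
  using order by (auto simp: valid_order_def)

lemma length_T: "length T = 2 * n"
proof -
  have "card (Pre ` {..<n} \<union> Post ` {..<n}) = card (Pre ` {..<n}) + card (Post ` {..<n})"
    by (rule card_Un_disjoint) auto
  also have "\<dots> = 2 * n" by (simp add: card_image inj_on_def)
  finally show ?thesis using distinct_card[OF distinct_T] set_T by simp
qed

lemma nth_T_eq_iff: "i < 2 * n \<Longrightarrow> k < 2 * n \<Longrightarrow> T ! i = T ! k \<longleftrightarrow> i = k"
  using nth_eq_iff_index_eq[OF distinct_T] length_T by simp

lemma in_take_iff: "k \<le> 2 * n \<Longrightarrow> t \<in> set (take k T) \<longleftrightarrow> (\<exists>i<k. T ! i = t)"
  using length_T by (auto simp: in_set_conv_nth)

lemma nth_in_take_iff: "k \<le> 2 * n \<Longrightarrow> i < 2 * n \<Longrightarrow> T ! i \<in> set (take k T) \<longleftrightarrow> i < k"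
  using nth_T_eq_iff by (auto simp: in_take_iff)

lemma Post_position:
  assumes "j < n"
  obtains m where "m < 2 * n" "T ! m = Post j"
proof -
  have "Post j \<in> set T" using assms set_T by auto
  then show ?thesis using that length_T by (auto simp: in_set_conv_nth)
qed

lemma Pre_before_Post: "l < 2 * n \<Longrightarrow> m < 2 * n \<Longrightarrow> T ! l = Pre j \<Longrightarrow> T ! m = Post j \<Longrightarrow> l < m"
proof -
  assume *: "l < 2 * n" "m < 2 * n" "T ! l = Pre j" "T ! m = Post j"
  then have "j < n" using set_T nth_mem[of l T] length_T by auto
  moreover have "\<forall>j<n. \<forall>k<length T. \<forall>m<length T. T ! k = Pre j \<and> T ! m = Post j \<longrightarrow> k < m"
    using order unfolding valid_order_def by (elim conjE)
  ultimately show "l < m" using * length_T by metis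
qed

lemma Pre_position:
  assumes "m < 2 * n" "T ! m = Post j"
  obtains l where "l < m" "T ! l = Pre j"
proof -
  have "j < n" using set_T nth_mem[of m T] length_T assms by auto
  then have "Pre j \<in> set T" using set_T by auto
  then obtain l where "l < 2 * n" "T ! l = Pre j" using length_T by (auto simp: in_set_conv_nth)
  then show ?thesis using that Pre_before_Post[of l m j] assms by simp
qed

lemma usable_mems:
  assumes "k < 2 * n"
  shows "usable (mems k) (T ! k)"
proof (cases "T ! k")
  case (Pre j)
  then show ?thesis using nth_in_take_iff[of k k] assms by (auto simp: usable_def set_open_mems)
next
  case (Post j)
  obtain l where "l < k" "T ! l = Pre j" using Pre_position assms Post by blast
  then have "Pre j \<in> set (take k T)" using assms by (auto simp: in_take_iff)
  then show ?thesis using nth_in_take_iff[of k k] Post assms by (auto simp: usable_def set_open_mems)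
qed

lemma mems_Suc:
  assumes "k < 2 * n"
  shows "mems (Suc k) = mems_after (mems k) (T ! k)"
proof -
  have "Post j \<notin> set (take k T)" if "T ! k = Pre j" for j
  proof
    assume "Post j \<in> set (take k T)"
    then obtain m where "m < k" "T ! m = Post j" using assms by (auto simp: in_take_iff)
    then show False using Pre_before_Post[OF assms _ that, of m] assms by simp
  qed
  then show ?thesis using open_mems_snoc[of "T ! k" "take k T"] assms length_T
    by (simp add: take_Suc_conv_app_nth)
qed

lemma distinct_mems: "distinct (mems k)"
  by (simp add: distinct_open_mems distinct_T)

lemma r_pos: "k < 2 * n \<Longrightarrow> 0 < r k"
proof (cases k)
  case (Suc i)
  assume "k < 2 * n"
  then show ?thesis using channel_pos(2)[OF inter[of i]] Suc by simp
qed (use r0 in simp)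

lemma comp_at_channel:
  assumes "k < 2 * n" "\<forall>j. superchan (\<Theta> j)"
  shows "comp_at \<Theta> k \<in> channels (mdim \<Theta> (mems k) * inp k) (mdim \<Theta> (mems (Suc k)) * out k)"
  using comp_map_channel[OF assms(2) r_pos[OF assms(1)] distinct_mems usable_mems[OF assms(1)]]
  by (simp add: mems_Suc[OF assms(1)])

lemma inter_at_channel:
  assumes "Suc k < 2 * n" "\<forall>j. superchan (\<Theta> j)"
  shows "inter_at \<Theta> k \<in> channels (mdim \<Theta> (mems (Suc k)) * out k) (mdim \<Theta> (mems (Suc k)) * inp (Suc k))"
  by (rule amp_channel'[OF inter[OF assms(1)]]) (use mdim_pos[OF assms(2)] in auto)

text \<open>On matrices of the right size, padding by no dimensions is the identity.\<close>

lemma id_channel: "0 < k \<Longrightarrow> id \<in> channels k k"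
  by (rule channel_cong[OF pad_zero_channel[of k k]]) (auto simp: pad_zero_def)

lemma bef_channel:
  assumes "k < 2 * n" "\<forall>j. superchan (\<Theta> j)"
  shows "bef \<Theta> k \<in> channels (c * r 0) (mdim \<Theta> (mems k) * inp k)"
  using assms(1)
proof (induction k)
  case 0
  \<comment> \<open>No memory is open at the start, so the first component cannot be a
    postprocessing, and the initial system is C with the reference.\<close>
  have "\<exists>j. T ! 0 = Pre j" using usable_mems[OF 0]
    by (cases "T ! 0") (auto simp: usable_def set_open_mems)
  then have "c * r 0 = mdim \<Theta> (mems 0) * inp 0" by (auto simp: open_mems_def)
  moreover have "id \<in> channels (c * r 0) (c * r 0)"
    using r0 superchannel_pos(4)[OF assms(2)[rule_format]] by (intro id_channel) simp
  ultimately show ?case by (simp only: bef.simps)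
next
  case (Suc k)
  then have k: "k < 2 * n" by simp
  show ?case unfolding bef.simps comp_assoc
    by (rule comp_channel[OF comp_channel[OF Suc.IH[OF k] comp_at_channel[OF k assms(2)]]
        inter_at_channel[OF Suc.prems assms(2)], unfolded comp_assoc])
qed

lemma aft_channel:
  assumes "k < 2 * n" "\<forall>j. superchan (\<Theta> j)"
  shows "aft \<Theta> k \<in> channels (c * r 0) (mdim \<Theta> (mems (Suc k)) * out k)"
  unfolding aft_def by (rule comp_channel[OF bef_channel[OF assms] comp_at_channel[OF assms]])

lemma Pre_if_in_take:
  assumes "k \<le> 2 * n" "t \<in> set (take k T)" "t = Pre i \<or> t = Post i"
  shows "Pre i \<in> set (take k T)"
proof -
  obtain m where m: "m < k" "T ! m = t" using assms by (auto simp: in_take_iff)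
  show ?thesis
  proof (cases "t = Pre i")
    case False
    then obtain l where "l < m" "T ! l = Pre i" using Pre_position[of m i] m assms by auto
    then show ?thesis using m assms(1) by (auto simp: in_take_iff intro: exI[of _ l])
  qed (use assms in simp)
qed

text \<open>An open memory or a postprocessing presupposes an earlier preprocessing of the same
  copy, so copies not yet begun have no influence.\<close>

lemma bef_cong:
  assumes "k < 2 * n" "\<And>i. Pre i \<in> set (take k T) \<Longrightarrow> \<Theta> i = \<Theta>' i"
  shows "bef \<Theta> k = bef \<Theta>' k"
  using assms
proof (induction k)
  case (Suc k)
  have k: "set (take k T) \<subseteq> set (take (Suc k) T)" by (rule set_take_subset_set_take) simp
  have "T ! k \<in> set (take (Suc k) T)" using Suc.prems(1) by (simp add: nth_in_take_iff)
  then have "\<Theta> i = \<Theta>' i" if "T ! k = Pre i \<or> T ! k = Post i" for i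
    using Suc.prems Pre_if_in_take[of "Suc k" "T ! k" i] that by auto
  moreover have "\<Theta> i = \<Theta>' i" if "i \<in> set (mems k) \<or> i \<in> set (mems (Suc k))" for i
    using that Suc.prems(2) k by (auto simp: set_open_mems)
  ultimately have "comp_at \<Theta> k = comp_at \<Theta>' k" "mdim \<Theta> (mems (Suc k)) = mdim \<Theta>' (mems (Suc k))"
    by (auto intro!: comp_map_cong mdim_cong)
  moreover have "bef \<Theta> k = bef \<Theta>' k" using Suc k by auto
  ultimately show ?case by (simp only: bef.simps)
qed simp

text \<open>Between the two components of copy \<open>j\<close>, the strategy acts as the identity on the memory of
  that copy, and otherwise as a channel that does not depend on the superchannel used for it.\<close>

lemma memory_untouched:
  assumes sup: "\<forall>i. superchan (\<Theta> i)" and lm: "l < m" "m < 2 * n" "T ! l = Pre j" "T ! m = Post j"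
    and k: "l < k" "k \<le> m"
  shows "\<exists>us vs L. mems k = us @ j # vs
    \<and> L \<in> channels (mdim \<Theta> (mems l) * (a * r l)) (mdim \<Theta> (us @ vs) * inp k)
    \<and> (\<forall>\<theta> X. swap_mid 1 (mdim \<Theta> us) (mem_dim \<theta>) (mdim \<Theta> vs * inp k) (bef (\<Theta>(j := \<theta>)) k X)
        = amp (mem_dim \<theta>) (mdim \<Theta> (mems l) * (a * r l)) (mdim \<Theta> (us @ vs) * inp k) 1 L
            (swap_mid 1 (mdim \<Theta> (mems l)) (mem_dim \<theta>) (a * r l) (aft (\<Theta>(j := \<theta>)) l X)))"
  using k
proof (induction k)
  case (Suc k)
  have upd: "mdim (\<Theta>(j := \<theta>)) js = mdim \<Theta> js" if "j \<notin> set js" for \<theta> js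
    using that by (intro mdim_cong) auto
  have Suck: "Suc k < 2 * n" using Suc.prems lm by simp
  show ?case
  proof (cases "k = l")
    case True
    have out: "out k = a * r l" using lm(3) True by simp
    have j: "j \<notin> set (mems l)" using usable_mems[of l] lm by (simp add: usable_def)
    have ms: "mems (Suc k) = mems l @ j # []" using mems_Suc[of l] lm True by (simp add: mems_after_def)
    let ?u = "mdim \<Theta> (mems l)"
    let ?L = "amp ?u (out k) (inp (Suc k)) 1 (inter k)"
    have "?L \<in> channels (?u * (a * r l)) (mdim \<Theta> (mems l @ []) * inp (Suc k))"
      unfolding out by (rule amp_channel'[OF inter[OF Suck, unfolded out]]) (use mdim_pos[OF sup] lm True in auto)
    moreover have "swap_mid 1 ?u (mem_dim \<theta>) (mdim \<Theta> [] * inp (Suc k)) (bef (\<Theta>(j := \<theta>)) (Suc k) X)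
        = amp (mem_dim \<theta>) (?u * (a * r l)) (mdim \<Theta> (mems l @ []) * inp (Suc k)) 1 ?L
            (swap_mid 1 ?u (mem_dim \<theta>) (a * r l) (aft (\<Theta>(j := \<theta>)) l X))" for \<theta> X
      using swap_amp_right[of 1 ?u "mem_dim \<theta>" 1 "inp (Suc k)" 1 "out k" "inter k" "aft (\<Theta>(j := \<theta>)) l X"]
        amp_amp[of "mem_dim \<theta>" ?u "out k" 1 "inp (Suc k)" 1 "inter k"
          "swap_mid 1 ?u (mem_dim \<theta>) (a * r l) (aft (\<Theta>(j := \<theta>)) l X)"]
      unfolding bef_Suc ms using upd[OF j, of \<theta>] lm(3) True
      by (simp add: mult.commute[of ?u])
    ultimately show ?thesis using ms by blast
  next
    case False
    then have "l < k" "k \<le> m" using Suc.prems by auto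
    from Suc.IH[OF this] obtain us vs L where IH: "mems k = us @ j # vs"
      "L \<in> channels (mdim \<Theta> (mems l) * (a * r l)) (mdim \<Theta> (us @ vs) * inp k)"
      "\<And>\<theta> X. swap_mid 1 (mdim \<Theta> us) (mem_dim \<theta>) (mdim \<Theta> vs * inp k) (bef (\<Theta>(j := \<theta>)) k X)
        = amp (mem_dim \<theta>) (mdim \<Theta> (mems l) * (a * r l)) (mdim \<Theta> (us @ vs) * inp k) 1 L
            (swap_mid 1 (mdim \<Theta> (mems l)) (mem_dim \<theta>) (a * r l) (aft (\<Theta>(j := \<theta>)) l X))"
      by blast
    have k: "k < 2 * n" "k < m" "l < k" using Suck Suc.prems False by auto
    have t: "T ! k \<noteq> Pre j" "T ! k \<noteq> Post j"
      using nth_T_eq_iff[of k l] nth_T_eq_iff[of k m] k lm by auto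
    have dist: "distinct (us @ j # vs)" using distinct_mems[of k] IH(1) by simp
    have us: "usable (us @ j # vs) (T ! k)" using usable_mems[OF k(1)] IH(1) by simp
    have mems: "mems (Suc k) = mems_after (us @ j # vs) (T ! k)" using mems_Suc[OF k(1)] IH(1) by simp
    note rem = comp_map_remove[OF dist us t, where a = a and b = b and c = c and d = d and r = "r k"]
    obtain us' vs' where 1: "mems (Suc k) = us' @ j # vs'" "mems_after (us @ vs) (T ! k) = us' @ vs'"
      using rem mems by metis
    have j: "j \<notin> set us" "j \<notin> set vs" "j \<notin> set us'" "j \<notin> set vs'"
      using dist distinct_mems[of "Suc k"] 1(1) by auto
    let ?u = "mdim \<Theta> us" and ?v = "mdim \<Theta> vs" and ?u' = "mdim \<Theta> us'" and ?v' = "mdim \<Theta> vs'"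
    let ?K = "comp_map a b c d \<Theta> (r k) (us @ vs) (T ! k)"
    let ?I = "amp (?u' * ?v') (out k) (inp (Suc k)) 1 (inter k)"
    have K: "?K \<in> channels (mdim \<Theta> (us @ vs) * inp k) (mdim \<Theta> (us' @ vs') * out k)"
      using comp_map_channel[OF sup r_pos[OF k(1)], of "us @ vs" "T ! k"] dist us t
      by (auto simp: 1(2) usable_def split: component.splits)
    have I: "?I \<in> channels (mdim \<Theta> (us' @ vs') * out k) (mdim \<Theta> (us' @ vs') * inp (Suc k))"
      by (rule amp_channel'[OF inter[OF Suck]]) (use mdim_pos[OF sup] in auto)
    have "swap_mid 1 ?u' (mem_dim \<theta>) (?v' * inp (Suc k)) (bef (\<Theta>(j := \<theta>)) (Suc k) X)
        = amp (mem_dim \<theta>) (mdim \<Theta> (mems l) * (a * r l)) (mdim \<Theta> (us' @ vs') * inp (Suc k)) 1 (?I \<circ> ?K \<circ> L)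
            (swap_mid 1 (mdim \<Theta> (mems l)) (mem_dim \<theta>) (a * r l) (aft (\<Theta>(j := \<theta>)) l X))" for \<theta> X
    proof -
      let ?\<Theta> = "\<Theta>(j := \<theta>)" and ?s = "mem_dim \<theta>"
      let ?Y = "comp_at ?\<Theta> k (bef ?\<Theta> k X)"
      let ?Z = "swap_mid 1 (mdim \<Theta> (mems l)) ?s (a * r l) (aft ?\<Theta> l X)"
      \<comment> \<open>Copy \<open>j\<close> does not act here and its memory is no longer listed.
        The update at \<open>j\<close> is therefore invisible, and the channel obtained is the same
        for every \<open>\<theta>\<close>.\<close>
      have K': "comp_map a b c d ?\<Theta> (r k) (us @ vs) (T ! k) = ?K"
        using j t by (intro comp_map_cong) auto
      have "swap_mid 1 ?u' ?s (?v' * out k) ?Y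
          = amp ?s (mdim \<Theta> (us @ vs) * inp k) (mdim \<Theta> (us' @ vs') * out k) 1 ?K
              (swap_mid 1 ?u ?s (?v * inp k) (bef ?\<Theta> k X))"
      \<comment> \<open>The splitting is obtained anew for the updated assignment; it coincides with
        \<open>us'\<close> and \<open>vs'\<close> because \<open>j\<close> occurs only once in the
        list of memories.\<close>
      proof (rule rem[where \<Theta> = ?\<Theta>])
        fix us'' vs''
        assume "mems_after (us @ j # vs) (T ! k) = us'' @ j # vs''"
          and 2: "mems_after (us @ vs) (T ! k) = us'' @ vs''"
            "\<And>X. swap_mid 1 (mdim ?\<Theta> us'') (mem_dim (?\<Theta> j)) (mdim ?\<Theta> vs'' * out k)
                (comp_map a b c d ?\<Theta> (r k) (us @ j # vs) (T ! k) X)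
              = amp (mem_dim (?\<Theta> j)) (mdim ?\<Theta> (us @ vs) * inp k) (mdim ?\<Theta> (us'' @ vs'') * out k) 1
                  (comp_map a b c d ?\<Theta> (r k) (us @ vs) (T ! k))
                  (swap_mid 1 (mdim ?\<Theta> us) (mem_dim (?\<Theta> j)) (mdim ?\<Theta> vs * inp k) X)"
        then have "us' @ j # vs' = us'' @ j # vs''" using mems 1(1) by simp
        then have "us'' = us'" "vs'' = vs'" using append_Cons_eq_iff[of j us' vs'] j by auto
        then show ?thesis using 2(2)[of "bef ?\<Theta> k X"] j
          by (simp add: upd K' IH(1) del: One_nat_def)
      qed
      also have "\<dots> = amp ?s (mdim \<Theta> (us @ vs) * inp k) (mdim \<Theta> (us' @ vs') * out k) 1 ?K
          (amp ?s (mdim \<Theta> (mems l) * (a * r l)) (mdim \<Theta> (us @ vs) * inp k) 1 L ?Z)"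
        by (simp only: IH(3))
      also have "\<dots> = amp ?s (mdim \<Theta> (mems l) * (a * r l)) (mdim \<Theta> (us' @ vs') * out k) 1 (\<lambda>Y. ?K (L Y)) ?Z"
        by (rule amp_comp) (rule channel_carrier[OF IH(2)])
      finally have Y: "swap_mid 1 ?u' ?s (?v' * out k) ?Y = \<dots>" .
      have "inter_at ?\<Theta> k = amp (1 * ?u' * ?s * ?v') (out k) (inp (Suc k)) 1 (inter k)"
        unfolding 1(1) using upd[of us' \<theta>] upd[of vs' \<theta>] j by (simp add: mult.assoc)
      then have "swap_mid 1 ?u' ?s (?v' * inp (Suc k)) (bef ?\<Theta> (Suc k) X)
          = swap_mid 1 ?u' ?s (?v' * inp (Suc k) * 1) (amp (1 * ?u' * ?s * ?v') (out k) (inp (Suc k)) 1 (inter k) ?Y)"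
        by simp
      also have "\<dots> = amp (1 * ?s * ?u' * ?v') (out k) (inp (Suc k)) 1 (inter k) (swap_mid 1 ?u' ?s (?v' * out k * 1) ?Y)"
        by (rule swap_amp_right)
      also have "\<dots> = amp ?s (mdim \<Theta> (us' @ vs') * out k) (mdim \<Theta> (us' @ vs') * inp (Suc k)) 1 ?I
          (swap_mid 1 ?u' ?s (?v' * out k) ?Y)"
        using amp_amp[of ?s "?u' * ?v'" "out k" 1 "inp (Suc k)" 1 "inter k" "swap_mid 1 ?u' ?s (?v' * out k) ?Y"]
        by (simp add: mult.assoc)
      also have "\<dots> = amp ?s (mdim \<Theta> (mems l) * (a * r l)) (mdim \<Theta> (us' @ vs') * inp (Suc k)) 1 (\<lambda>Y. ?I (?K (L Y))) ?Z"
        unfolding Y by (rule amp_comp) (rule channel_carrier[OF K channel_carrier[OF IH(2)]])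
      finally show ?thesis by (simp only: comp_def)
    qed
    moreover have "?I \<circ> ?K \<circ> L \<in> channels (mdim \<Theta> (mems l) * (a * r l)) (mdim \<Theta> (us' @ vs') * inp (Suc k))"
      by (rule comp_channel[OF IH(2) comp_channel[OF K I]])
    ultimately show ?thesis using 1(1) by blast
  qed
qed simp

end

lemma super_apply_channel:
  assumes \<theta>: "is_superchannel a b c d \<theta>" and N: "N \<in> channels (a * r) (b * r)" and "0 < r"
  shows "super_apply a b c d r \<theta> N \<in> channels (c * r) (d * r)"
proof -
  have 1: "amp 1 c (mem_dim \<theta> * a) r (pre \<theta>) \<in> channels (c * r) (mem_dim \<theta> * (a * r))"
    by (rule amp_channel'[of _ c "mem_dim \<theta> * a"]) (use \<theta> assms(3) in \<open>auto simp: is_superchannel_def\<close>)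
  have 2: "amp (mem_dim \<theta>) (a * r) (b * r) 1 N \<in> channels (mem_dim \<theta> * (a * r)) (mem_dim \<theta> * (b * r))"
    by (rule amp_channel'[OF N]) (use superchannel_pos[OF \<theta>] in auto)
  have 3: "amp 1 (mem_dim \<theta> * b) d r (post \<theta>) \<in> channels (mem_dim \<theta> * (b * r)) (d * r)"
    by (rule amp_channel'[of _ "mem_dim \<theta> * b" d]) (use \<theta> assms(3) in \<open>auto simp: is_superchannel_def\<close>)
  show ?thesis unfolding super_apply_def by (rule comp_channel[OF 1 comp_channel[OF 2 3]])
qed

context adaptive
begin

text \<open>The memory of copy \<open>j\<close> goes to the far left and the memories of the other
  open copies to the far right, where they join the reference; this is the layout of
  \<open>super_apply\<close>. The same \<open>N\<close> and \<open>L\<close> serve every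
  \<open>\<theta>\<close>: nothing before the first component involves copy \<open>j\<close>, and
  afterwards its memory is left alone.\<close>

lemma comb_factorization:
  assumes sup: "\<forall>i. superchan (\<Theta> i)" and lm: "l < m" "m < 2 * n" "T ! l = Pre j" "T ! m = Post j"
    and ms: "mems m = us @ j # vs"
  obtains z N L where "0 < z" "N \<in> channels (c * r 0) (c * z)"
    "L \<in> channels (a * z) (b * (r m * mdim \<Theta> (us @ vs)))"
    "\<And>\<theta> X. swap_mid 1 (mdim \<Theta> (us @ vs)) (mem_dim \<theta> * (b * r m)) 1
          (swap_mid (mdim \<Theta> us) (mem_dim \<theta>) (mdim \<Theta> vs) (b * r m) (bef (\<Theta>(j := \<theta>)) m X))
        = amp (mem_dim \<theta>) (a * z) (b * (r m * mdim \<Theta> (us @ vs))) 1 L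
            (amp 1 c (mem_dim \<theta> * a) z (pre \<theta>) (N X))"
proof -
  obtain us' vs' L where L: "mems m = us' @ j # vs'"
    "L \<in> channels (mdim \<Theta> (mems l) * (a * r l)) (mdim \<Theta> (us' @ vs') * inp m)"
    "\<And>\<theta> X. swap_mid 1 (mdim \<Theta> us') (mem_dim \<theta>) (mdim \<Theta> vs' * inp m) (bef (\<Theta>(j := \<theta>)) m X)
        = amp (mem_dim \<theta>) (mdim \<Theta> (mems l) * (a * r l)) (mdim \<Theta> (us' @ vs') * inp m) 1 L
            (swap_mid 1 (mdim \<Theta> (mems l)) (mem_dim \<theta>) (a * r l) (aft (\<Theta>(j := \<theta>)) l X))"
    using memory_untouched[OF sup lm lm(1) order_refl] by blast
  have "distinct (us @ j # vs)" "distinct (us' @ j # vs')" using distinct_mems[of m] ms L(1) by simp_all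
  then have "us' = us" "vs' = vs" using append_Cons_eq_iff[of j us' vs' us vs] ms L(1) by auto
  note L = L(2,3)[unfolded this]
  have inp: "inp m = b * r m" using lm(4) by simp
  have j: "j \<notin> set (mems l)" using usable_mems[of l] lm by (simp add: usable_def)
  let ?U = "mdim \<Theta> (mems l)" and ?W = "mdim \<Theta> (us @ vs)" and ?y = "b * r m"
  have pos: "0 < ?U" "0 < ?W" "0 < r l" "0 < r m" "0 < a" "0 < b" "0 < c"
    using mdim_pos[OF sup] r_pos lm superchannel_pos[OF sup[rule_format]] by auto
  \<comment> \<open>The reference of the preprocessing includes the memories of the copies opened
    earlier.\<close>
  let ?z = "r l * ?U"
  let ?N = "swap_mid 1 ?U (c * r l) 1 \<circ> bef \<Theta> l"
  let ?S = "swap_mid 1 (a * r l) ?U 1" and ?S' = "swap_mid 1 ?W ?y 1"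
  have S: "?S \<in> channels (a * ?z) (?U * (a * r l))"
    by (rule swap_mid_channel') (use pos in auto)
  have S': "?S' \<in> channels (?W * ?y) (b * (r m * ?W))"
    by (rule swap_mid_channel') (use pos in auto)
  have bef: "bef (\<Theta>(j := \<theta>)) l = bef \<Theta> l" for \<theta>
  proof (rule bef_cong)
    fix i assume "Pre i \<in> set (take l T)"
    then have "i \<noteq> j" using nth_in_take_iff[of l l] lm by auto
    then show "(\<Theta>(j := \<theta>)) i = \<Theta> i" by simp
  qed (use lm in simp)
  have aft: "aft (\<Theta>(j := \<theta>)) l X = amp ?U c (mem_dim \<theta> * a) (r l) (pre \<theta>) (bef \<Theta> l X)" for \<theta> X
  proof -
    have "mdim (\<Theta>(j := \<theta>)) (mems l) = ?U" using j by (intro mdim_cong) auto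
    then show ?thesis by (simp add: aft_def lm(3) comp_map_Pre bef)
  qed
  show ?thesis
  proof (rule that)
    show "0 < ?z" using pos by simp
    have "bef \<Theta> l \<in> channels (c * r 0) (?U * (c * r l))"
      using bef_channel[of l \<Theta>] sup lm by simp
    moreover have "swap_mid 1 ?U (c * r l) 1 \<in> channels (?U * (c * r l)) (c * ?z)"
      by (rule swap_mid_channel') (use pos in auto)
    ultimately show "?N \<in> channels (c * r 0) (c * ?z)" by (rule comp_channel)
    show "?S' \<circ> L \<circ> ?S \<in> channels (a * ?z) (b * (r m * ?W))"
      by (rule comp_channel[OF S comp_channel[OF L(1)[unfolded inp] S', unfolded comp_assoc], folded comp_assoc])
    fix \<theta> X
    let ?s = "mem_dim \<theta>" and ?\<Theta> = "\<Theta>(j := \<theta>)"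
    let ?V = "amp 1 c (?s * a) ?z (pre \<theta>) (?N X)"
    have "swap_mid 1 ?U ?s (a * r l) (aft ?\<Theta> l X)
        = swap_mid ?s (a * r l) ?U 1 (swap_mid 1 ?U (?s * a * r l) 1 (aft ?\<Theta> l X))"
      using swap_eq_swap_swap_all[of ?U ?s "a * r l"] by (simp add: mult.assoc)
    also have "\<dots> = swap_mid ?s (a * r l) ?U 1 ?V"
      unfolding aft swap_amp_left by simp
    also have "\<dots> = amp ?s (a * ?z) (?U * (a * r l)) 1 ?S ?V"
      using amp_swap_mid[of ?s 1 "a * r l" ?U 1 1 ?V] by (simp add: mult.assoc mult.left_commute mult.commute)
    finally have 1: "swap_mid 1 ?U ?s (a * r l) (aft ?\<Theta> l X) = \<dots>" .
    have "swap_mid 1 ?W (?s * ?y) 1 (swap_mid (mdim \<Theta> us) ?s (mdim \<Theta> vs) ?y (bef ?\<Theta> m X))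
        = swap_mid ?s ?W ?y 1 (swap_mid 1 (mdim \<Theta> us) ?s (mdim \<Theta> vs * ?y) (bef ?\<Theta> m X))"
      using swap_all_swap[of "mdim \<Theta> us" "mdim \<Theta> vs" ?s ?y] by simp
    also have "\<dots> = swap_mid ?s ?W ?y 1 (amp ?s (?U * (a * r l)) (?W * ?y) 1 L (amp ?s (a * ?z) (?U * (a * r l)) 1 ?S ?V))"
      using L(2)[of \<theta> X] unfolding inp 1 by simp
    also have "\<dots> = swap_mid ?s ?W ?y 1 (amp ?s (a * ?z) (?W * ?y) 1 (\<lambda>Y. L (?S Y)) ?V)"
      by (rule arg_cong[OF amp_comp]) (rule channel_carrier[OF S])
    also have "\<dots> = amp ?s (?W * ?y) (b * (r m * ?W)) 1 ?S' (amp ?s (a * ?z) (?W * ?y) 1 (\<lambda>Y. L (?S Y)) ?V)"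
      using amp_swap_mid[of ?s 1 ?W ?y 1 1] by (simp add: mult.assoc)
    also have "\<dots> = amp ?s (a * ?z) (b * (r m * ?W)) 1 (\<lambda>Y. ?S' (L (?S Y))) ?V"
      by (rule amp_comp) (rule channel_carrier[OF L(1)[unfolded inp] channel_carrier[OF S]])
    finally show "swap_mid 1 ?W (?s * ?y) 1 (swap_mid (mdim \<Theta> us) ?s (mdim \<Theta> vs) ?y (bef ?\<Theta> m X))
        = amp ?s (a * ?z) (b * (r m * ?W)) 1 (?S' \<circ> L \<circ> ?S) ?V"
      by (simp only: comp_def)
  qed
qed

text \<open>The strategy up to the second component of copy \<open>j\<close>, in the form of the definition of
  \<^const>\<open>fully_amortized_div\<close>: everything before the first component is \<open>N'\<close>, everything
  between the two is \<open>N\<close>. The reference is padded to a dimension \<open>R\<close> that can be chosen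
  to be the same before and after, and for both superchannels.\<close>

lemma padded_factorization:
  assumes sup: "\<forall>i. superchan (\<Theta> i)" and lm: "l < m" "m < 2 * n" "T ! l = Pre j" "T ! m = Post j"
    and ms: "mems m = us @ j # vs"
  obtains z where "0 < z" "\<And>R. 0 < R \<Longrightarrow> z dvd R \<Longrightarrow> r m * mdim \<Theta> (us @ vs) \<le> R \<Longrightarrow>
    \<exists>N N'. N \<in> channels (a * R) (b * R) \<and> N' \<in> channels (c * r 0) (c * R)
      \<and> (\<forall>\<theta> X. superchan \<theta> \<longrightarrow> super_apply a b c d R \<theta> N (N' X)
          = amp d (r m * mdim \<Theta> (us @ vs)) R 1 (pad_zero (r m * mdim \<Theta> (us @ vs)) R)
              (swap_mid 1 (mdim \<Theta> (us @ vs)) (d * r m) 1 (aft (\<Theta>(j := \<theta>)) m X)))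
      \<and> (\<forall>\<theta> X. superchan \<theta> \<longrightarrow> insert_channel a b c R (mem_dim \<theta>) (pre \<theta>) N (N' X)
          = amp (mem_dim \<theta> * b) (r m * mdim \<Theta> (us @ vs)) R 1 (pad_zero (r m * mdim \<Theta> (us @ vs)) R)
              (swap_mid 1 (mdim \<Theta> (us @ vs)) (mem_dim \<theta> * (b * r m)) 1
                (swap_mid (mdim \<Theta> us) (mem_dim \<theta>) (mdim \<Theta> vs) (b * r m) (bef (\<Theta>(j := \<theta>)) m X))))"
proof -
  let ?W = "mdim \<Theta> (us @ vs)"
  let ?z = "r m * ?W"
  obtain z N' L where z: "0 < z" and N': "N' \<in> channels (c * r 0) (c * z)" and L: "L \<in> channels (a * z) (b * ?z)"
    and eq: "\<And>\<theta> X. swap_mid 1 ?W (mem_dim \<theta> * (b * r m)) 1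
          (swap_mid (mdim \<Theta> us) (mem_dim \<theta>) (mdim \<Theta> vs) (b * r m) (bef (\<Theta>(j := \<theta>)) m X))
        = amp (mem_dim \<theta>) (a * z) (b * ?z) 1 L (amp 1 c (mem_dim \<theta> * a) z (pre \<theta>) (N' X))"
    using comb_factorization[OF sup lm ms] by blast
  have pos: "0 < a" "0 < b" "0 < c" "0 < ?z"
    using superchannel_pos[OF sup[rule_format]] mdim_pos[OF sup] r_pos lm by auto
  have j: "j \<notin> set us" "j \<notin> set vs" using distinct_mems[of m] ms by auto
  show ?thesis
  proof (rule that[OF z])
    fix R assume R: "0 < R" "z dvd R" "?z \<le> R"
    then obtain q where q: "R = q * z" by (metis dvd_div_mult_self)
    then have "0 < q" using R by (auto intro: ccontr)
    have "z \<le> R" using R(1,2) by (rule dvd_imp_le[rotated])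
    let ?N = "amp b ?z R 1 (pad_zero ?z R) \<circ> L \<circ> amp a R z 1 (ptrace q z)"
    let ?P = "amp c z R 1 (pad_zero z R)"
    have "amp a R z 1 (ptrace q z) \<in> channels (a * R) (a * z)"
      using amp_channel'[OF ptrace_channel[OF z \<open>0 < q\<close>], of "a * R" a 1 "a * z"] pos by (simp add: q)
    moreover have "amp b ?z R 1 (pad_zero ?z R) \<in> channels (b * ?z) (b * R)"
      using amp_channel'[OF pad_zero_channel[OF pos(4) R(3)], of "b * ?z" b 1 "b * R"] pos by simp
    ultimately have N: "?N \<in> channels (a * R) (b * R)"
      using L by (metis comp_channel)
    have "?P \<in> channels (c * z) (c * R)"
      using amp_channel'[OF pad_zero_channel[OF z \<open>z \<le> R\<close>], of "c * z" c 1 "c * R"] pos by simp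
    then have PN': "?P \<circ> N' \<in> channels (c * r 0) (c * R)" using N' by (metis comp_channel)
    let ?V = "\<lambda>\<theta> X. amp (mem_dim \<theta>) (a * z) (b * ?z) 1 L (amp 1 c (mem_dim \<theta> * a) z (pre \<theta>) (N' X))"
    have core: "amp (mem_dim \<theta>) (a * R) (b * R) 1 ?N (amp 1 c (mem_dim \<theta> * a) R (pre \<theta>) (?P (N' X)))
        = amp (mem_dim \<theta> * b) ?z R 1 (pad_zero ?z R) (?V \<theta> X)" if "superchan \<theta>" for \<theta> X
      by (rule padded_comb[OF L q \<open>0 < q\<close>]) (use that in \<open>simp add: is_superchannel_def\<close>)
    have "super_apply a b c d R \<theta> ?N ((?P \<circ> N') X)
        = amp d ?z R 1 (pad_zero ?z R) (swap_mid 1 ?W (d * r m) 1 (aft (\<Theta>(j := \<theta>)) m X))"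
      if \<theta>: "superchan \<theta>" for \<theta> X
    proof -
      let ?\<Theta> = "\<Theta>(j := \<theta>)" and ?s = "mem_dim \<theta>"
      have post: "post \<theta> \<in> channels (?s * b) d" using \<theta> by (simp add: is_superchannel_def)
      have upd: "mdim ?\<Theta> us = mdim \<Theta> us" "mdim ?\<Theta> vs = mdim \<Theta> vs" using j by (auto intro: mdim_cong)
      have "super_apply a b c d R \<theta> ?N ((?P \<circ> N') X)
          = amp 1 (?s * b) d R (post \<theta>) (amp (?s * b) ?z R 1 (pad_zero ?z R) (?V \<theta> X))"
        using core[OF \<theta>] by (simp add: super_apply_def)
      also have "\<dots> = amp d ?z R 1 (pad_zero ?z R) (amp 1 (?s * b) d ?z (post \<theta>) (?V \<theta> X))"
        by (rule amp_pad_zero[OF post])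
      also have "amp 1 (?s * b) d ?z (post \<theta>) (?V \<theta> X) = amp 1 (?s * b) d ?z (post \<theta>) (swap_mid 1 ?W (?s * b * r m) 1
            (swap_mid (mdim \<Theta> us) ?s (mdim \<Theta> vs) (b * r m) (bef ?\<Theta> m X)))"
        by (simp only: eq[symmetric] mult.assoc)
      also have "\<dots> = swap_mid 1 ?W (d * r m) 1 (aft ?\<Theta> m X)"
        unfolding swap_amp_left[symmetric] aft_def ms lm(4) comp_map_Post[OF j(1)] upd by simp
      finally show ?thesis .
    qed
    \<comment> \<open>Inserting \<open>pre \<theta>\<close> differs from applying
      \<open>\<theta>\<close> only by the missing postprocessing, so \<open>core\<close> is used as
      it stands.\<close>
    moreover have "insert_channel a b c R (mem_dim \<theta>) (pre \<theta>) ?N ((?P \<circ> N') X)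
        = amp (mem_dim \<theta> * b) ?z R 1 (pad_zero ?z R)
            (swap_mid 1 ?W (mem_dim \<theta> * (b * r m)) 1
              (swap_mid (mdim \<Theta> us) (mem_dim \<theta>) (mdim \<Theta> vs) (b * r m) (bef (\<Theta>(j := \<theta>)) m X)))"
      if "superchan \<theta>" for \<theta> X
      using core[OF that, of X] unfolding eq by (simp add: insert_channel_def)
    ultimately show "\<exists>N N'. N \<in> channels (a * R) (b * R) \<and> N' \<in> channels (c * r 0) (c * R)
      \<and> (\<forall>\<theta> X. superchan \<theta> \<longrightarrow> super_apply a b c d R \<theta> N (N' X)
          = amp d ?z R 1 (pad_zero ?z R) (swap_mid 1 ?W (d * r m) 1 (aft (\<Theta>(j := \<theta>)) m X)))
      \<and> (\<forall>\<theta> X. superchan \<theta> \<longrightarrow> insert_channel a b c R (mem_dim \<theta>) (pre \<theta>) N (N' X)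
          = amp (mem_dim \<theta> * b) ?z R 1 (pad_zero ?z R)
              (swap_mid 1 ?W (mem_dim \<theta> * (b * r m)) 1
                (swap_mid (mdim \<Theta> us) (mem_dim \<theta>) (mdim \<Theta> vs) (b * r m) (bef (\<Theta>(j := \<theta>)) m X))))"
      using N PN' by blast
  qed
qed

lemma component_less: "t \<in> set T \<Longrightarrow> t = Pre i \<or> t = Post i \<Longrightarrow> i < n"
  using set_T by auto

lemma mems_less: "i \<in> set (mems k) \<Longrightarrow> i < n"
  using component_less[of "Pre i" i] set_take_subset[of k T] by (auto simp: set_open_mems)

text \<open>A copy whose postprocessing has been used neither acts again nor has an open memory. On
  all other copies the two assignments agree, so the remaining steps form one channel
  \<open>\<Phi>\<close>.\<close>

lemma later_steps_common:
  assumes sup: "\<forall>i. superchan (\<Theta> i)" and k: "m \<le> k" "k < 2 * n"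
    and eq: "\<And>i. i < n \<Longrightarrow> Post i \<notin> set (take (Suc m) T) \<Longrightarrow> \<Theta> i = \<Theta>' i"
  shows "\<exists>\<Phi> \<in> channels (mdim \<Theta> (mems (Suc m)) * out m) (mdim \<Theta> (mems (Suc k)) * out k).
    aft \<Theta> k = \<Phi> \<circ> aft \<Theta> m \<and> aft \<Theta>' k = \<Phi> \<circ> aft \<Theta>' m"
  using k
proof (induction k rule: dec_induct)
  case base
  then have "0 < mdim \<Theta> (mems (Suc m)) * out m" using aft_channel[of m \<Theta>] sup channel_pos(2) by blast
  then show ?case using id_channel by (intro bexI[of _ id]) auto
next
  case (step k)
  then have "k < 2 * n" by simp
  from step.IH[OF this] obtain \<Phi> where \<Phi>: "\<Phi> \<in> channels (mdim \<Theta> (mems (Suc m)) * out m) (mdim \<Theta> (mems (Suc k)) * out k)"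
    "aft \<Theta> k = \<Phi> \<circ> aft \<Theta> m" "aft \<Theta>' k = \<Phi> \<circ> aft \<Theta>' m" by blast
  have k: "Suc k < 2 * n" using step by simp
  have sub: "set (take (Suc m) T) \<subseteq> set (take (Suc k) T)"
    using step by (intro set_take_subset_set_take) simp
  have mems: "\<Theta> i = \<Theta>' i" if "i \<in> set (mems (Suc k))" for i
    using that eq[of i] mems_less[of i "Suc k"] sub by (auto simp: set_open_mems)
  have comp: "\<Theta> i = \<Theta>' i" if i: "T ! Suc k = Pre i \<or> T ! Suc k = Post i" for i
  proof (rule eq)
    show "i < n" using component_less[of "T ! Suc k" i] i k length_T by auto
    show "Post i \<notin> set (take (Suc m) T)"
    proof
      assume "Post i \<in> set (take (Suc m) T)"
      then obtain p where p: "p < Suc m" "T ! p = Post i" using k step by (auto simp: in_take_iff)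
      then have "p < Suc k" "p < 2 * n" using step k by auto
      \<comment> \<open>Copy \<open>i\<close> would act after its own postprocessing:
        \<open>Post i\<close> cannot occur twice, and \<open>Pre i\<close> cannot follow it.\<close>
      then show False using i p(2) nth_T_eq_iff[of p "Suc k"] Pre_before_Post[of "Suc k" p i] k by auto
    qed
  qed
  have *: "inter_at \<Theta>' k = inter_at \<Theta> k" "comp_at \<Theta>' (Suc k) = comp_at \<Theta> (Suc k)"
    using mdim_cong[of "mems (Suc k)" \<Theta> \<Theta>'] mems comp by (auto intro!: comp_map_cong)
  have "comp_at \<Theta> (Suc k) \<circ> inter_at \<Theta> k \<circ> \<Phi> \<in> channels (mdim \<Theta> (mems (Suc m)) * out m)
      (mdim \<Theta> (mems (Suc (Suc k))) * out (Suc k))"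
    by (rule comp_channel[OF \<Phi>(1) comp_channel[OF inter_at_channel[OF k sup] comp_at_channel[OF k sup]]])
  moreover have "aft \<Theta> (Suc k) = comp_at \<Theta> (Suc k) \<circ> inter_at \<Theta> k \<circ> \<Phi> \<circ> aft \<Theta> m"
    "aft \<Theta>' (Suc k) = comp_at \<Theta> (Suc k) \<circ> inter_at \<Theta> k \<circ> \<Phi> \<circ> aft \<Theta>' m"
    unfolding aft_def[of _ "Suc k"] bef_Suc \<Phi>(2,3) * by (simp_all only: comp_assoc)
  ultimately show ?case by blast
qed

section \<open>Removing one copy at a time\<close>

lemma aft_cong:
  assumes "k < 2 * n" "\<And>i. i < n \<Longrightarrow> \<Theta> i = \<Theta>' i"
  shows "aft \<Theta> k = aft \<Theta>' k"
proof -
  have T: "T ! k \<in> set T" using assms(1) length_T by simp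
  have "comp_at \<Theta> k = comp_at \<Theta>' k"
    using mems_less component_less[OF T] assms(2) by (intro comp_map_cong) auto
  moreover have "bef \<Theta> k = bef \<Theta>' k"
    using component_less set_take_subset[of k T] assms by (intro bef_cong) blast+
  ultimately show ?thesis by (simp only: aft_def)
qed

text \<open>\<open>J\<close> is the set of copies still to be discriminated. The position
  \<open>k\<close> is free, subject to all copies in \<open>J\<close> being closed, because the
  induction hypothesis is needed directly before the component that is dropped rather than at the
  end of the strategy.\<close>

lemma hybrid_bound:
  assumes D: "generalized_divergence D"
  shows "\<lbrakk>\<forall>i. superchan (\<Theta> i); \<forall>i. superchan (\<Theta>' i); J \<subseteq> {..<n}; card J = N;
    \<And>i. i \<in> J \<Longrightarrow> \<Theta> i = \<theta> \<and> \<Theta>' i = \<theta>'; \<And>i. i < n \<Longrightarrow> i \<notin> J \<Longrightarrow> \<Theta> i = \<Theta>' i;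
    k < 2 * n; \<And>i. i \<in> J \<Longrightarrow> Post i \<in> set (take (Suc k) T)\<rbrakk> \<Longrightarrow>
    amortized_div D (c * r 0) (mdim \<Theta> (mems (Suc k)) * out k) (aft \<Theta> k) (aft \<Theta>' k)
      \<le> ereal (real N) * fully_amortized_div D a b c d \<theta> \<theta>'"
proof (induction N arbitrary: J \<Theta> \<Theta>' k)
  case 0
  have "finite J" using 0(3) by (rule finite_subset) simp
  then have eq: "\<Theta> i = \<Theta>' i" if "i < n" for i using 0(4,6) that by auto
  have "aft \<Theta>' k = aft \<Theta> k"
    using aft_cong[OF 0(7)] eq by metis
  then show ?case using amortized_div_same[OF D aft_channel[OF 0(7,1)]] by (simp add: zero_ereal_def[symmetric])
next
  case (Suc N)
  note sup = Suc.prems(1) and sup' = Suc.prems(2)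
  have fin: "finite J" using Suc.prems(3) by (rule finite_subset) simp
  let ?S = "{m. m < 2 * n \<and> (\<exists>j\<in>J. T ! m = Post j)}"
  define m where "m = Max ?S"
  have "J \<noteq> {}" using Suc.prems(4) by auto
  then have "?S \<noteq> {}" using Suc.prems(3) Post_position by (metis (mono_tags, lifting) all_not_in_conv lessThan_iff mem_Collect_eq subsetD)
  then have "m \<in> ?S" unfolding m_def by (intro Max_in) auto
  then obtain j where m: "m < 2 * n" and j: "j \<in> J" "T ! m = Post j" by auto
  have before: "Post i \<in> set (take (Suc m) T)" if i: "i \<in> J" for i
  proof -
    obtain p where p: "p < 2 * n" "T ! p = Post i" using Post_position[of i] Suc.prems(3) i by blast
    then have "p \<le> m" unfolding m_def using i by (intro Max_ge) auto
    then show ?thesis using p m nth_in_take_iff[of "Suc m" p] by simp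
  qed
  have "m \<le> k"
    using Suc.prems(8)[OF j(1)] nth_in_take_iff[of "Suc k" m] m j(2) Suc.prems(7) by simp
  obtain l where l: "l < m" "T ! l = Pre j" using Pre_position[OF m j(2)] .
  then obtain m' where m': "m = Suc m'" by (cases m) auto
  have "j \<in> set (mems m)" using usable_mems[OF m] j(2) by (simp add: usable_def)
  then obtain us vs where ms: "mems m = us @ j # vs" by (auto dest: split_list)
  then have ms_Suc: "mems (Suc m) = us @ vs" "j \<notin> set us" "j \<notin> set vs"
    using mems_Suc[OF m] distinct_mems[of m] j(2) by (auto simp: mems_after_def filter_neq)
  \<comment> \<open>After position \<open>m\<close> all copies in \<open>J\<close> are closed, so
    the open memories belong to copies with the same superchannel on both sides, and
    \<open>?W\<close> is their dimension for both.\<close>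
  have common: "\<Theta> i = \<Theta>' i" if "i \<in> set (us @ vs)" for i
  proof -
    have "i \<in> set (mems (Suc m))" using that ms_Suc by simp
    then show ?thesis using Suc.prems(6)[of i] before[of i] mems_less[of i "Suc m"]
      by (auto simp: set_open_mems)
  qed
  let ?u = "mdim \<Theta> us" and ?v = "mdim \<Theta> vs" and ?W = "mdim \<Theta> (us @ vs)"
  have mdim': "mdim \<Theta>' us = ?u" "mdim \<Theta>' vs = ?v" "mdim \<Theta>' (us @ vs) = ?W"
    by (rule mdim_cong; use common in auto)+
  let ?z = "r m * ?W"
  have pos: "0 < a" "0 < b" "0 < c" "0 < d" "0 < ?W" "0 < r m" "0 < ?z"
    using superchannel_pos[OF sup[rule_format]] mdim_pos[OF sup] r_pos[OF m] by auto
  obtain z where z: "0 < z" and fact: "\<And>R. 0 < R \<Longrightarrow> z dvd R \<Longrightarrow> ?z \<le> R \<Longrightarrow>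
    \<exists>N N'. N \<in> channels (a * R) (b * R) \<and> N' \<in> channels (c * r 0) (c * R)
      \<and> (\<forall>\<theta> X. superchan \<theta> \<longrightarrow> super_apply a b c d R \<theta> N (N' X)
          = amp d ?z R 1 (pad_zero ?z R) (swap_mid 1 ?W (d * r m) 1 (aft (\<Theta>(j := \<theta>)) m X)))
      \<and> (\<forall>\<theta> X. superchan \<theta> \<longrightarrow> insert_channel a b c R (mem_dim \<theta>) (pre \<theta>) N (N' X)
          = amp (mem_dim \<theta> * b) ?z R 1 (pad_zero ?z R)
              (swap_mid 1 ?W (mem_dim \<theta> * (b * r m)) 1
                (swap_mid ?u (mem_dim \<theta>) ?v (b * r m) (bef (\<Theta>(j := \<theta>)) m X))))"
    using padded_factorization[OF sup l(1) m l(2) j(2) ms] by blast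
  obtain z' where z': "0 < z'" and fact': "\<And>R. 0 < R \<Longrightarrow> z' dvd R \<Longrightarrow> ?z \<le> R \<Longrightarrow>
    \<exists>N N'. N \<in> channels (a * R) (b * R) \<and> N' \<in> channels (c * r 0) (c * R)
      \<and> (\<forall>\<theta> X. superchan \<theta> \<longrightarrow> super_apply a b c d R \<theta> N (N' X)
          = amp d ?z R 1 (pad_zero ?z R) (swap_mid 1 ?W (d * r m) 1 (aft (\<Theta>'(j := \<theta>)) m X)))
      \<and> (\<forall>\<theta> X. superchan \<theta> \<longrightarrow> insert_channel a b c R (mem_dim \<theta>) (pre \<theta>) N (N' X)
          = amp (mem_dim \<theta> * b) ?z R 1 (pad_zero ?z R)
              (swap_mid 1 ?W (mem_dim \<theta> * (b * r m)) 1
                (swap_mid ?u (mem_dim \<theta>) ?v (b * r m) (bef (\<Theta>'(j := \<theta>)) m X))))"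
    using padded_factorization[OF sup' l(1) m l(2) j(2) ms, unfolded mdim'] by blast
  \<comment> \<open>The references at the first component have dimensions \<open>z\<close> and
    \<open>z'\<close> on the two sides. The product with \<open>?z\<close> is a multiple of both, is
    at least \<open>?z\<close>, and lets the partial trace over \<open>q\<close> undo the padding
    from \<open>?z\<close>.\<close>
  define q where "q = z * z'"
  define R where "R = q * ?z"
  have q: "0 < q" using z z' by (simp add: q_def)
  have R: "0 < R" "z dvd R" "z' dvd R" "?z \<le> R" using q pos by (auto simp: R_def q_def)
  obtain K K0 where K: "K \<in> channels (a * R) (b * R)" "K0 \<in> channels (c * r 0) (c * R)"
    "\<And>\<theta> X. superchan \<theta> \<Longrightarrow> super_apply a b c d R \<theta> K (K0 X)
          = amp d ?z R 1 (pad_zero ?z R) (swap_mid 1 ?W (d * r m) 1 (aft (\<Theta>(j := \<theta>)) m X))"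
    "\<And>\<theta> X. superchan \<theta> \<Longrightarrow> insert_channel a b c R (mem_dim \<theta>) (pre \<theta>) K (K0 X)
          = amp (mem_dim \<theta> * b) ?z R 1 (pad_zero ?z R)
              (swap_mid 1 ?W (mem_dim \<theta> * (b * r m)) 1
                (swap_mid ?u (mem_dim \<theta>) ?v (b * r m) (bef (\<Theta>(j := \<theta>)) m X)))"
    using fact[OF R(1,2,4)] by blast
  obtain M M0 where M: "M \<in> channels (a * R) (b * R)" "M0 \<in> channels (c * r 0) (c * R)"
    "\<And>\<theta> X. superchan \<theta> \<Longrightarrow> super_apply a b c d R \<theta> M (M0 X)
          = amp d ?z R 1 (pad_zero ?z R) (swap_mid 1 ?W (d * r m) 1 (aft (\<Theta>'(j := \<theta>)) m X))"
    "\<And>\<theta> X. superchan \<theta> \<Longrightarrow> insert_channel a b c R (mem_dim \<theta>) (pre \<theta>) M (M0 X)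
          = amp (mem_dim \<theta> * b) ?z R 1 (pad_zero ?z R)
              (swap_mid 1 ?W (mem_dim \<theta> * (b * r m)) 1
                (swap_mid ?u (mem_dim \<theta>) ?v (b * r m) (bef (\<Theta>'(j := \<theta>)) m X)))"
    using fact'[OF R(1,3,4)] by blast
  have \<theta>: "\<Theta> j = \<theta>" "\<Theta>' j = \<theta>'" "superchan \<theta>" "superchan \<theta>'" "\<Theta>(j := \<theta>) = \<Theta>" "\<Theta>'(j := \<theta>') = \<Theta>'"
    using Suc.prems(5)[OF j(1)] sup sup' by auto
  let ?A' = "amortized_div D (c * r 0) (d * R) (super_apply a b c d R \<theta> K \<circ> K0) (super_apply a b c d R \<theta>' M \<circ> M0)"
  let ?B = "\<lambda>s F. amortized_div D (c * r 0) (s * b * R) (insert_channel a b c R s F K \<circ> K0) (insert_channel a b c R s F M \<circ> M0)"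
  have "amortized_div D (c * r 0) (mdim \<Theta> (mems (Suc k)) * out k) (aft \<Theta> k) (aft \<Theta>' k)
      \<le> amortized_div D (c * r 0) (mdim \<Theta> (mems (Suc m)) * out m) (aft \<Theta> m) (aft \<Theta>' m)"
  proof -
    have "\<Theta> i = \<Theta>' i" if "i < n" "Post i \<notin> set (take (Suc m) T)" for i
      using Suc.prems(6)[OF that(1)] before[of i] that(2) by blast
    from later_steps_common[OF sup \<open>m \<le> k\<close> Suc.prems(7) this]
    obtain \<Phi> where \<Phi>: "\<Phi> \<in> channels (mdim \<Theta> (mems (Suc m)) * out m) (mdim \<Theta> (mems (Suc k)) * out k)"
      "aft \<Theta> k = \<Phi> \<circ> aft \<Theta> m" "aft \<Theta>' k = \<Phi> \<circ> aft \<Theta>' m" by blast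
    have "aft \<Theta>' m \<in> channels (c * r 0) (mdim \<Theta> (mems (Suc m)) * out m)"
      using aft_channel[OF m sup'] mdim'(3) ms_Suc(1) by simp
    then show ?thesis
      by (intro amortized_div_data_processing[OF D \<Phi>(1) aft_channel[OF m sup]]) (simp_all add: \<Phi>(2,3))
  qed
  also have "\<dots> \<le> ereal (real (Suc N)) * fully_amortized_div D a b c d \<theta> \<theta>'"
  proof (rule amortization_step)
    show "Inf {div_diff ?A' (?B s F) | s F. F \<in> channels c (s * a)} \<le> fully_amortized_div D a b c d \<theta> \<theta>'"
      unfolding fully_amortized_div_def
      by (rule Sup_upper, rule CollectI, intro exI conjI, rule refl, rule K(1), rule M(1), rule K(2), rule M(2))
    \<comment> \<open>This undoes the padding and returns the other memories to the left, so passing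
      to the padded form loses nothing.\<close>
    let ?\<Phi> = "swap_mid 1 (d * r m) ?W 1 \<circ> amp d R ?z 1 (ptrace q ?z)"
    have "amp d R ?z 1 (ptrace q ?z) \<in> channels (d * R) (d * ?z)"
      using amp_channel'[OF ptrace_channel[OF pos(7) q], of "d * R" d 1 "d * ?z"] pos by (simp add: R_def)
    moreover have "swap_mid 1 (d * r m) ?W 1 \<in> channels (d * ?z) (?W * (d * r m))"
      by (rule swap_mid_channel') (use pos in auto)
    ultimately have \<Phi>: "?\<Phi> \<in> channels (d * R) (mdim \<Theta> (mems (Suc m)) * out m)"
      using j(2) ms_Suc(1) comp_channel by fastforce
    have undo: "Y = ?\<Phi> (amp d ?z R 1 (pad_zero ?z R) (swap_mid 1 ?W (d * r m) 1 Y))"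
      if Y: "Y \<in> carrier_mat (?W * (d * r m)) (?W * (d * r m))" for Y
    proof -
      let ?Y = "swap_mid 1 ?W (d * r m) 1 Y"
      have Y': "?Y \<in> carrier_mat (d * ?z * 1) (d * ?z * 1)"
        using swap_mid_carrier[of 1 ?W "d * r m" 1 Y] by (simp only: mult_1 mult_1_right mult.assoc)
      have "amp d R ?z 1 (ptrace q ?z) (amp d ?z R 1 (pad_zero ?z R) ?Y)
          = amp d ?z ?z 1 (\<lambda>X. ptrace q ?z (pad_zero ?z R X)) ?Y"
        by (rule amp_comp) (simp add: pad_zero_def)
      also have "\<dots> = ?Y"
        by (rule amp_id[OF _ Y']) (simp add: R_def ptrace_pad_zero q)
      finally show ?thesis using swap_mid_inverse[of Y 1 ?W "d * r m" 1] Y by simp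
    qed
    have aft: "aft \<Theta> m X \<in> carrier_mat (?W * (d * r m)) (?W * (d * r m))"
      "aft \<Theta>' m X \<in> carrier_mat (?W * (d * r m)) (?W * (d * r m))"
      if "X \<in> carrier_mat (c * r 0) (c * r 0)" for X
      using channel_carrier[OF aft_channel[OF m sup] that] channel_carrier[OF aft_channel[OF m sup'] that]
        ms_Suc(1) mdim'(3) j(2) by simp_all
    show "amortized_div D (c * r 0) (mdim \<Theta> (mems (Suc m)) * out m) (aft \<Theta> m) (aft \<Theta>' m) \<le> ?A'"
    proof (rule amortized_div_data_processing[OF D \<Phi>])
      show "super_apply a b c d R \<theta> K \<circ> K0 \<in> channels (c * r 0) (d * R)"
        "super_apply a b c d R \<theta>' M \<circ> M0 \<in> channels (c * r 0) (d * R)"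
        using comp_channel[OF K(2) super_apply_channel[OF \<theta>(3) K(1) R(1)]]
          comp_channel[OF M(2) super_apply_channel[OF \<theta>(4) M(1) R(1)]] by simp_all
      fix X :: "complex mat" assume X: "X \<in> carrier_mat (c * r 0) (c * r 0)"
      show "aft \<Theta> m X = ?\<Phi> ((super_apply a b c d R \<theta> K \<circ> K0) X)"
        using undo[OF aft(1)[OF X]] K(3)[OF \<theta>(3), of X] \<theta>(5) by simp
      show "aft \<Theta>' m X = ?\<Phi> ((super_apply a b c d R \<theta>' M \<circ> M0) X)"
        using undo[OF aft(2)[OF X]] M(3)[OF \<theta>(4), of X] \<theta>(6) by simp
    qed
  next
    fix s F assume F: "F \<in> channels c (s * a)"
    then have "0 < s" using channel_pos(2) by fastforce
    \<comment> \<open>Any \<open>G\<close> completes \<open>F\<close> to a superchannel: the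
      comparison below ends before the second component of copy \<open>j\<close>.\<close>
    then obtain G where G: "G \<in> channels (s * b) d" using channels_nonempty[of "s * b" d] pos by auto
    define \<theta>F where "\<theta>F = \<lparr>mem_dim = s, pre = F, post = G\<rparr>"
    have \<theta>F: "superchan \<theta>F" "mem_dim \<theta>F = s" "pre \<theta>F = F"
      using F G by (simp_all add: \<theta>F_def is_superchannel_def)
    let ?\<Theta> = "\<Theta>(j := \<theta>F)" and ?\<Theta>' = "\<Theta>'(j := \<theta>F)"
    have sF: "\<forall>i. superchan (?\<Theta> i)" "\<forall>i. superchan (?\<Theta>' i)" using sup sup' \<theta>F(1) by auto
    have upd: "mdim ?\<Theta> us = ?u" "mdim ?\<Theta> vs = ?v" "mdim ?\<Theta>' us = ?u" "mdim ?\<Theta>' vs = ?v"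
      by (rule mdim_cong; use ms_Suc common in auto)+
    have mF: "mdim ?\<Theta> (mems m) = ?u * (s * ?v)" "mdim ?\<Theta>' (mems m) = ?u * (s * ?v)"
      by (simp_all add: ms upd \<theta>F(2))
    have m'_less: "m' < 2 * n" using m m' by simp
    \<comment> \<open>Copy \<open>j\<close> carries \<open>\<theta>F\<close> on both sides and
      leaves \<open>J\<close>. The other copies of \<open>J\<close> are closed by position
      \<open>m'\<close>, since \<open>m\<close> is the last of the postprocessings
      considered.\<close>
    have IH: "amortized_div D (c * r 0) (mdim ?\<Theta> (mems (Suc m')) * out m') (aft ?\<Theta> m') (aft ?\<Theta>' m')
      \<le> ereal (real N) * fully_amortized_div D a b c d \<theta> \<theta>'"
    proof (rule Suc.IH[OF sF])
      show "J - {j} \<subseteq> {..<n}" "card (J - {j}) = N" using Suc.prems(3,4) j(1) by auto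
      show "?\<Theta> i = \<theta> \<and> ?\<Theta>' i = \<theta>'" if "i \<in> J - {j}" for i using Suc.prems(5)[of i] that by auto
      show "?\<Theta> i = ?\<Theta>' i" if "i < n" "i \<notin> J - {j}" for i using Suc.prems(6)[of i] that by auto
      show "m' < 2 * n" by (rule m'_less)
      show "Post i \<in> set (take (Suc m') T)" if i: "i \<in> J - {j}" for i
      proof -
        obtain p where p: "p < Suc m" "T ! p = Post i" using before[of i] i m by (auto simp: in_take_iff)
        moreover have "p \<noteq> m" using p(2) j(2) i by auto
        ultimately show ?thesis using m by (auto simp: in_take_iff m' intro!: exI[of _ p])
      qed
    qed
    let ?I = "inter_at ?\<Theta> m'"
    \<comment> \<open>What leads from the output at \<open>m'\<close> to the form with
      \<open>F\<close> inserted: the interjected channel, the move of memory \<open>j\<close> to its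
      place, the move of the others into the reference, and padding. It is the same channel on both
      sides.\<close>
    let ?\<Psi> = "amp (s * b) ?z R 1 (pad_zero ?z R) \<circ> swap_mid 1 ?W (s * (b * r m)) 1 \<circ> swap_mid ?u s ?v (b * r m) \<circ> ?I"
    have inp: "inp m = b * r m" using j(2) by simp
    have 1: "?I \<in> channels (mdim ?\<Theta> (mems (Suc m')) * out m') (?u * (s * ?v) * (b * r m))"
      using inter_at_channel[where \<Theta> = ?\<Theta>, OF _ sF(1), of m'] m unfolding m'[symmetric] mF(1) inp
      by (simp only:)
    have 2: "swap_mid ?u s ?v (b * r m) \<in> channels (?u * (s * ?v) * (b * r m)) (?W * (s * (b * r m)))"
      by (rule swap_mid_channel') (use pos \<open>0 < s\<close> in auto)
    have 3: "swap_mid 1 ?W (s * (b * r m)) 1 \<in> channels (?W * (s * (b * r m))) (s * b * ?z)"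
      by (rule swap_mid_channel') (use pos \<open>0 < s\<close> in auto)
    have 4: "amp (s * b) ?z R 1 (pad_zero ?z R) \<in> channels (s * b * ?z) (s * b * R)"
      by (rule amp_channel'[OF pad_zero_channel[OF pos(7) R(4)]]) (use pos \<open>0 < s\<close> in auto)
    have \<Psi>: "?\<Psi> \<in> channels (mdim ?\<Theta> (mems (Suc m')) * out m') (s * b * R)"
      by (rule comp_channel[OF 1 comp_channel[OF 2 comp_channel[OF 3 4]]])
    have "?B s F \<le> amortized_div D (c * r 0) (mdim ?\<Theta> (mems (Suc m')) * out m') (aft ?\<Theta> m') (aft ?\<Theta>' m')"
    proof (rule amortized_div_data_processing[OF D \<Psi> aft_channel[OF m'_less sF(1)]])
      show "aft ?\<Theta>' m' \<in> channels (c * r 0) (mdim ?\<Theta> (mems (Suc m')) * out m')"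
        using aft_channel[where \<Theta> = ?\<Theta>', OF m'_less sF(2)] unfolding m'[symmetric] mF .
      have "inter_at ?\<Theta>' m' = ?I" unfolding m'[symmetric] mF ..
      then show "(insert_channel a b c R s F K \<circ> K0) X = ?\<Psi> (aft ?\<Theta> m' X)"
        "(insert_channel a b c R s F M \<circ> M0) X = ?\<Psi> (aft ?\<Theta>' m' X)" for X
        using K(4)[OF \<theta>F(1), of X] M(4)[OF \<theta>F(1), of X] unfolding \<theta>F(2,3) m' bef_Suc by simp_all
    qed
    also note IH
    finally show "?B s F \<le> ereal (real N) * fully_amortized_div D a b c d \<theta> \<theta>'" .
  qed
  finally show ?case .
qed

end

section \<open>From the strategies of the definition to the channels above\<close>

lemma strategy_state_eq_aft:
  assumes "adaptive a b c d n (comp_order \<S>) (ref_dim \<S>) (inter \<S>)"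
  shows "strategy_state a b c d \<S> \<Theta> k
    = adaptive.aft a b c d (comp_order \<S>) (ref_dim \<S>) (inter \<S>) (\<lambda>_. \<Theta>) k (init \<S>)"
proof -
  interpret adaptive a b c d n "comp_order \<S>" "ref_dim \<S>" "inter \<S>" by (rule assms)
  have mdim: "mdim (\<lambda>_. \<Theta>) js = mem_dim \<Theta> ^ length js" for js
    by (induction js) simp_all
  have comp: "apply_component a b c d \<Theta> R ts t X = comp_map a b c d (\<lambda>_. \<Theta>) R (open_mems ts) t X" for R ts t X
  proof (cases t)
    case (Post j)
    let ?ms = "open_mems ts" and ?P = "\<lambda>i. i \<noteq> j"
    have "length (takeWhile ?P ?ms) + length (dropWhile ?P ?ms) = length ?ms"
      by (metis length_append takeWhile_dropWhile_id)
    then have "length (tl (dropWhile ?P ?ms)) = length ?ms - 1 - length (takeWhile ?P ?ms)" by simp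
    then show ?thesis
      by (simp add: Post apply_component_def comp_map_def mdim Let_def power_add)
  qed (simp add: apply_component_def comp_map_Pre mdim Let_def)
  show ?thesis
  proof (induction k)
    case 0
    then show ?case by (simp add: aft_def comp open_mems_def)
  next
    case (Suc k)
    then show ?case by (simp add: aft_def[of _ "Suc k"] bef_Suc comp mdim Let_def del: bef.simps)
  qed
qed

theorem theorem5p5:
  fixes D :: "complex mat \<Rightarrow> complex mat \<Rightarrow> ereal"
    and a b c d n :: nat
    and \<Theta>\<^sub>1 \<Theta>\<^sub>2 :: superchannel
    and \<S> :: strategy
  assumes "generalized_divergence D"
    and "weakly_faithful D"
    and "is_superchannel a b c d \<Theta>\<^sub>1"
    and "is_superchannel a b c d \<Theta>\<^sub>2"
    and "n \<ge> 1"
    and "adaptive_strategy a b c d n \<S>"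
  shows "D (decision_dist a b c d n \<S> \<Theta>\<^sub>1) (decision_dist a b c d n \<S> \<Theta>\<^sub>2)
           \<le> ereal (real n) * fully_amortized_div D a b c d \<Theta>\<^sub>1 \<Theta>\<^sub>2"
proof -
  let ?e = "d * ref_dim \<S> (2 * n - 1)"
  have \<S>: "valid_order n (comp_order \<S>)" "init \<S> \<in> states (c * ref_dim \<S> 0)"
    "\<And>k. k < 2 * n - 1 \<Longrightarrow> inter \<S> k \<in> channels (out_dim a d (comp_order \<S> ! k) * ref_dim \<S> k)
      (in_dim b c (comp_order \<S> ! Suc k) * ref_dim \<S> (Suc k))"
    "psd ?e (povm \<S> 0)" "psd ?e (povm \<S> 1)" "povm \<S> 0 + povm \<S> 1 = 1\<^sub>m ?e"
    using assms(6) by (auto simp: adaptive_strategy_def Let_def)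
  interpret adaptive a b c d n "comp_order \<S>" "ref_dim \<S>" "inter \<S>"
  proof
    show "0 < ref_dim \<S> 0" using states_pos[OF \<S>(2)] by simp
    show "inter \<S> k \<in> channels (out_dim a d (comp_order \<S> ! k) * ref_dim \<S> k)
      (in_dim b c (comp_order \<S> ! Suc k) * ref_dim \<S> (Suc k))" if "Suc k < 2 * n" for k
      using \<S>(3)[of k] that by simp
  qed (rule \<S>(1))
  \<comment> \<open>The last position; positivity of \<open>n\<close> makes the truncated
    subtraction exact.\<close>
  define k where "k = 2 * n - 1"
  have k: "k < 2 * n" "Suc k = 2 * n" using assms(5) by (simp_all add: k_def)
  have all: "take (Suc k) (comp_order \<S>) = comp_order \<S>" using length_T k by simp
  \<comment> \<open>A final preprocessing would leave no room for its postprocessing. Hence the last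
    system is D, and below no memory remains open.\<close>
  have Post: "\<exists>j. comp_order \<S> ! k = Post j"
  proof (cases "comp_order \<S> ! k")
    case (Pre j)
    then have "j < n" using component_less[of "Pre j"] nth_mem[of k "comp_order \<S>"] k length_T by auto
    then obtain m where "m < 2 * n" "comp_order \<S> ! m = Post j" by (rule Post_position)
    then have False using Pre_before_Post[of k m j] Pre k by simp
    then show ?thesis ..
  qed auto
  have "set (mems (Suc k)) = {}" using mems_less set_T all by (auto simp: set_open_mems)
  then have dims: "mdim \<Theta> (mems (Suc k)) * out k = ?e" for \<Theta> using Post by (auto simp: k_def)
  let ?\<rho> = "\<lambda>\<Theta>. aft (\<lambda>_. \<Theta>) k (init \<S>)"
  have dist: "decision_dist a b c d n \<S> \<Theta> = povm_map (povm \<S>) (?\<rho> \<Theta>)" for \<Theta>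
    by (simp add: decision_dist_def povm_map_def strategy_state_eq_aft[OF adaptive_axioms] k_def)
  have ch: "aft (\<lambda>_. \<Theta>) k \<in> channels (c * ref_dim \<S> 0) ?e" if "is_superchannel a b c d \<Theta>" for \<Theta>
    using aft_channel[OF k(1), of "\<lambda>_. \<Theta>"] that dims by simp
  have st: "?\<rho> \<Theta> \<in> states ?e" if "is_superchannel a b c d \<Theta>" for \<Theta>
    using channel_states[OF ch[OF that] \<S>(2)] .
  have "povm_map (povm \<S>) \<in> channels ?e 2"
    using povm_map_channel[OF \<S>(4-6)] channel_pos(2)[OF ch[OF assms(3)]] by simp
  then have "D (decision_dist a b c d n \<S> \<Theta>\<^sub>1) (decision_dist a b c d n \<S> \<Theta>\<^sub>2) \<le> D (?\<rho> \<Theta>\<^sub>1) (?\<rho> \<Theta>\<^sub>2)"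
    unfolding dist using assms(1) st[OF assms(3)] st[OF assms(4)] by (auto simp: generalized_divergence_def)
  also have "\<dots> \<le> amortized_div D (c * ref_dim \<S> 0) ?e (aft (\<lambda>_. \<Theta>\<^sub>1) k) (aft (\<lambda>_. \<Theta>\<^sub>2) k)"
    by (rule div_le_amortized_div[OF assms(1,2) ch[OF assms(3)] ch[OF assms(4)] \<S>(2)])
  also have "\<dots> \<le> ereal (real n) * fully_amortized_div D a b c d \<Theta>\<^sub>1 \<Theta>\<^sub>2"
  proof -
    \<comment> \<open>All \<open>n\<close> copies are discriminated, and the last position has
      closed every one of them.\<close>
    have "Post i \<in> set (take (Suc k) (comp_order \<S>))" if "i < n" for i
      using that set_T all by auto
    then show ?thesis
      using hybrid_bound[OF assms(1), of "\<lambda>_. \<Theta>\<^sub>1" "\<lambda>_. \<Theta>\<^sub>2" "{..<n}" n \<Theta>\<^sub>1 \<Theta>\<^sub>2 k] assms(3,4) k(1) dims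
      by simp
  qed
  finally show ?thesis .
qed

end
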